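(* Assume the setting and notation described in the context, and assume moreover that $N=2$ and $t=e-1\ge 2$. Then $\mathcal{C}_{(a_1,\ldots,a_t)}$ is an $[n,tm]$ cyclic code over $\mathbb{F}_q$ with minimal Hamming distance $d=\frac{2(q-1)(r-\sqrt r)}{(t+1)q\delta}$, and the Hamming weights of its codewords are as follows: the value $0$ is taken once, and for every pair of integers $(k,u)$ with $2\le k\le t+1$ and $0\le u\le k$, the value $$\frac{q-1}{(t+1)q\delta}\Big[k(r-1)-2u\,\eta_0-2(k-u)\,\eta_1\Big]$$ is taken with frequency $$\sum_{k_0=0}^{k}\sum_{u_0=0}^{u}\binom{l_0+1}{k_0}\binom{l_1}{k-k_0}\binom{k_0}{u_0}\binom{k-k_0}{u-u_0}\,\Omega_{2u_0+k-k_0-u,\;k_0+u-2u_0},$$ where a summand is taken to be $0$ whenever its binomial product vanishes (frequencies of coinciding values being added).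
   Context: Let $p$ be a prime, $s,m\ge 1$ integers, $q=p^s$, $r=q^m$, and let $\gamma$ be a generator of $\mathbb{F}_r^*$. Let $e\ge t\ge 2$ be integers with $e\mid(r-1)$, let $a$ be an integer with $a\not\equiv 0\pmod{r-1}$, and let $\Delta_1,\ldots,\Delta_t$ be integers, pairwise incongruent modulo $e$, with $\gcd(\Delta_2-\Delta_1,\ldots,\Delta_t-\Delta_1,e)=1$. Let $a_i\equiv a+\frac{r-1}{e}\Delta_i\pmod{r-1}$ for $1\le i\le t$. Assume that the minimal polynomials $h_{a_i}(x)$ of $\gamma^{-a_i}$ over $\mathbb{F}_q$ all have degree $m$ and are pairwise distinct. Put $N=\gcd\!\left(\frac{r-1}{q-1},ae\right)$, $\delta=\gcd(r-1,a_1,\ldots,a_t)$, $n=\frac{r-1}{\delta}$, and $$\mathcal{C}_{(a_1,\ldots,a_t)}=\left\{\left(\mathrm{Tr}_{r/q}\Big(\sum_{j=1}^t x_j\gamma^{a_j i}\Big)\right)_{i=0}^{n-1} : x_1,\ldots,x_t\in\mathbb{F}_r\right\}.$$ Let $g=\gamma^a$ and $\beta=\gamma^{(r-1)/e}$. Let $B$ be the $(t+1)\times t$ matrix over $\mathbb{F}_r$ with entries $B_{h,i}=\beta^{h\Delta_i}$ ($0\le h\le t$, $1\le i\le t$), and for $(x_1,\ldots,x_t)\in\mathbb{F}_r^t$ set $(y_0,\ldots,y_t)^T=B(x_1,\ldots,x_t)^T$. Any $t$ rows of $B$ are linearly independent, so there are unique $\lambda_1,\ldots,\lambda_t\in\mathbb{F}_r$,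 all nonzero, such that $y_0+\sum_{i=1}^t\lambda_i y_i=0$ for all $(x_1,\dots,x_t)$. Let $l_0=\#\{1\le i\le t:\lambda_i g^i \text{ is a square in }\mathbb{F}_r\}$ and $l_1=\#\{1\le i\le t:\lambda_i g^i \text{ is a nonsquare in }\mathbb{F}_r\}$. Let $\psi(c)=e^{2\pi\sqrt{-1}\,\mathrm{Tr}_{r/p}(c)/p}$ be the canonical additive character of $\mathbb{F}_r$, let $\eta_0=\sum_{x}\psi(x)$ with $x$ running over the nonzero squares of $\mathbb{F}_r$, and $\eta_1=-1-\eta_0$. Binomial coefficients $\binom{n}{i}$ are $0$ for $i<0$ or $i>n$. For integers $u,v\ge 0$ with $u+v\ge 2$ let $$\Omega_{u,v}=\frac{r-1}{r\,2^{u+v+1}}\Big\{2(r-1)^{u+v-1}+(-1)^{u+v}\big[(1+\sqrt r)^u(1-\sqrt r)^v+(1-\sqrt r)^u(1+\sqrt r)^v\big]\Big\}.$$ *)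

theory Defs
  imports
    Complex_Main
    "HOL-Library.FuncSet"
    "HOL-Library.Cardinality"
    "HOL-Computational_Algebra.Nth_Powers"
    "HOL-Number_Theory.Cong"
    "Jordan_Normal_Form.VS_Connect"
begin

text \<open>
  The extension \<open>F\<^sub>r / F\<^sub>q\<close> is given by two finite field types \<open>'k\<close> (for \<open>F\<^sub>q\<close>) and
  \<open>'a\<close> (for \<open>F\<^sub>r\<close>) together with a field homomorphism \<open>\<iota> :: 'k \<Rightarrow> 'a\<close>, which is automatically
  injective. Vectors over \<open>F\<^sub>q\<close> are zero-based, matching codeword coordinates \<open>0, \<dots>, n - 1\<close>.
\<close>

definition mult_generator :: "'a::field \<Rightarrow> bool" where
  "mult_generator \<gamma> \<longleftrightarrow> range (\<lambda>k::int. \<gamma> powi k) = UNIV - {0}"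

definition min_poly :: "('k::field \<Rightarrow> 'a::field) \<Rightarrow> 'a \<Rightarrow> 'k poly" where
  "min_poly \<iota> x = (THE f. lead_coeff f = 1 \<and> poly (map_poly \<iota> f) x = 0 \<and>
     (\<forall>g. g \<noteq> 0 \<and> poly (map_poly \<iota> g) x = 0 \<longrightarrow> degree f \<le> degree g))"

text \<open>
  The sum of the \<open>m\<close> conjugates \<open>x ^ (q ^ i)\<close> lies in the image of \<open>F\<^sub>q\<close>; the trace is its
  preimage under \<open>\<iota>\<close>.
\<close>

definition rel_trace :: "('k::{field,finite} \<Rightarrow> 'a::field) \<Rightarrow> nat \<Rightarrow> 'a \<Rightarrow> 'k" where
  "rel_trace \<iota> m x = (THE c. \<iota> c = (\<Sum>i<m. x ^ (CARD('k) ^ i)))"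

text \<open>
  The absolute trace from a field with \<open>p ^ k\<close> elements, as the representative in
  \<open>{0, \<dots>, p - 1}\<close> of an element of the prime field.
\<close>

definition abs_trace :: "nat \<Rightarrow> nat \<Rightarrow> 'a::field \<Rightarrow> nat" where
  "abs_trace p k c = (THE j. j < p \<and> of_nat j = (\<Sum>i<k. c ^ (p ^ i)))"

definition add_char :: "nat \<Rightarrow> nat \<Rightarrow> 'a::field \<Rightarrow> complex" where
  "add_char p k c = exp (2 * of_real pi * \<i> * of_nat (abs_trace p k c) / of_nat p)"

definition hamming_weight :: "'k::zero vec \<Rightarrow> nat" where
  "hamming_weight c = card {i. i < dim_vec c \<and> c $ i \<noteq> 0}"

definition hamming_dist :: "'k vec \<Rightarrow> 'k vec \<Rightarrow> nat" where
  "hamming_dist c d = card {i. i < dim_vec c \<and> c $ i \<noteq> d $ i}"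

definition min_distance :: "'k vec set \<Rightarrow> nat" where
  "min_distance C = Inf {hamming_dist c d | c d. c \<in> C \<and> d \<in> C \<and> c \<noteq> d}"

definition cyclic_shift :: "'k vec \<Rightarrow> 'k vec" where
  "cyclic_shift c = vec (dim_vec c) (\<lambda>i. c $ ((i + dim_vec c - 1) mod dim_vec c))"

definition is_cyclic_code :: "nat \<Rightarrow> nat \<Rightarrow> 'k::field vec set \<Rightarrow> bool" where
  "is_cyclic_code n k C \<longleftrightarrow>
     VectorSpace.subspace class_ring C (module_vec TYPE('k) n) \<and>
     vectorspace.dim class_ring (module_vec TYPE('k) n \<lparr>carrier := C\<rparr>) = k \<and>
     (\<forall>c\<in>C. cyclic_shift c \<in> C)"

definition trace_code ::
  "('k::{field,finite} \<Rightarrow> 'a::field) \<Rightarrow> nat \<Rightarrow> 'a \<Rightarrow> nat \<Rightarrow> nat \<Rightarrow> (nat \<Rightarrow> int) \<Rightarrow> 'k vec set"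
where
  "trace_code \<iota> m \<gamma> n t as =
     {vec n (\<lambda>i. rel_trace \<iota> m (\<Sum>j=1..t. x j * \<gamma> powi (as j * int i))) | x :: nat \<Rightarrow> 'a. True}"

text \<open>Column \<open>i\<close> of the zero-based matrix belongs to \<open>\<Delta> (i + 1)\<close>.\<close>

definition B_mat :: "'a::field \<Rightarrow> nat \<Rightarrow> (nat \<Rightarrow> int) \<Rightarrow> 'a mat" where
  "B_mat \<beta> t \<Delta> = mat (t + 1) t (\<lambda>(h, i). \<beta> powi (int h * \<Delta> (i + 1)))"

definition relation_coeffs :: "'a::field mat \<Rightarrow> nat \<Rightarrow> nat \<Rightarrow> 'a" where
  "relation_coeffs B t = (THE l. l \<in> extensional {1..t} \<and>
     (\<forall>x\<in>carrier_vec t. (B *\<^sub>v x) $ 0 + (\<Sum>i=1..t. l i * (B *\<^sub>v x) $ i) = 0))"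

definition Omega :: "nat \<Rightarrow> nat \<Rightarrow> nat \<Rightarrow> real" where
  "Omega r u v = (real r - 1) / (real r * 2 ^ (u + v + 1)) *
     (2 * (real r - 1) ^ (u + v - 1) +
      (- 1) ^ (u + v) * ((1 + sqrt r) ^ u * (1 - sqrt r) ^ v + (1 - sqrt r) ^ u * (1 + sqrt r) ^ v))"

end

theory Submission
  imports Defs
begin

text \<open>
  Since \<open>t = e - 1\<close>, the vector \<open>y\<close> is the discrete Fourier transform of length \<open>e\<close> of a vector
  with one prescribed zero entry. Hence \<open>x \<mapsto> y\<close> is a bijection onto a hyperplane
  \<open>\<Sum>h. \<lambda>\<^sub>h y\<^sub>h = 0\<close> in which every \<open>\<lambda>\<^sub>h\<close> is a power of \<open>\<beta>\<close>.
  Splitting the coordinate index modulo \<open>e\<close>, the weight becomes a sum over \<open>h\<close> of the number of \<open>l\<close> with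
  \<open>Tr (g\<^sup>h y\<^sub>h \<gamma>\<^bsup>ael\<^esup>) \<noteq> 0\<close>. This condition is invariant under scaling by the small field,
  and as \<open>N = 2\<close> the powers of \<open>\<gamma>\<^bsup>ae\<^esup>\<close> together with the small field generate the group of squares;
  so each count depends only on the square class of \<open>g\<^sup>h y\<^sub>h\<close> and is given by a quadratic Gaussian period.
  The frequencies count the points of the hyperplane with prescribed square classes, which is a
  character sum evaluated by the square of the quadratic Gauss sum. All nonzero words have
  positive weight, which gives the dimension by counting.
\<close>

section \<open>Finite fields\<close>

text \<open>Putting \<open>w_h = \<lambda>_h y_h\<close> turns the hyperplane into the plain
  condition that the \<open>w_h\<close> sum to zero. The count of zero sums depends on the classes
  of the \<open>w_h\<close>, the weight on those of \<open>g^h y_h\<close>; the two differ by the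
  class of \<open>\<lambda>_h g^h\<close>. This is where \<open>l0\<close> and \<open>l1\<close>
  come from, and \<open>l0 + 1\<close> arises because the coefficient at \<open>h = 0\<close> is 1.
  \<open>N = 2\<close> also makes (r-1)/(q-1) even, so every nonzero element of the small field is a
  square in the large one. In particular -1 is a square, the squared Gauss sum is \<open>r\<close>,
  and the two periods are the real numbers (-1 + sqrt r)/2 and (-1 - sqrt r)/2 in some order. That
  order is never determined: \<open>Omega\<close> is unchanged when sqrt r changes sign, and the
  minimum distance is attained for either order, since among three coefficients two share a square
  class.\<close>

lemma finite_field_power_card:
  fixes x :: "'a::{field,finite}"
  shows "x ^ CARD('a) = x"
proof (cases "x = 0")
  case False
  have "x * (\<Prod>y\<in>UNIV-{0}. x * y) = x * x ^ (CARD('a) - 1) * \<Prod>(UNIV-{0})"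
    by (simp add: prod.distrib mult_ac)
  also have "x * x ^ (CARD('a) - 1) = x ^ CARD('a)"
    by (metis One_nat_def Suc_pred finite_UNIV_card_ge_0 finite_class.finite_UNIV power_Suc)
  also have "(\<Prod>y\<in>UNIV-{0}. x * y) = (\<Prod>y\<in>UNIV-{0}. y)"
    by (rule prod.reindex_bij_witness[of _ "\<lambda>y. y / x" "\<lambda>y. x * y"]) (use False in auto)
  finally show ?thesis
    by simp
qed auto

text \<open>Translation by 1 permutes the ring, so the sum of all elements does not change when 1 is
  added to each of them.\<close>

lemma of_nat_CARD_eq_0: "of_nat CARD('a::{ring_1,finite}) = (0 :: 'a)"
proof -
  have "(\<Sum>x\<in>UNIV. x) = (\<Sum>x\<in>UNIV. x + 1 :: 'a)"
    by (rule sum.reindex_bij_witness[of _ "\<lambda>x. x + 1" "\<lambda>x. x - 1"]) auto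
  then show ?thesis by (simp add: sum.distrib)
qed

lemma CHAR_eq_prime:
  assumes "prime p" "CARD('a::{field,finite}) = p ^ k"
  shows "CHAR('a) = p"
proof -
  have "CHAR('a) > 0" by (simp add: finite_imp_CHAR_pos)
  then have "prime CHAR('a)" using prime_CHAR_semidom by blast
  moreover have "CHAR('a) dvd p ^ k" 
    using of_nat_CARD_eq_0[where 'a='a] assms by (simp only: of_nat_eq_0_iff_char_dvd)
  ultimately show ?thesis
    using assms(1) by (metis prime_dvd_power primes_dvd_imp_eq)
qed

lemma of_nat_eq_iff_cong_CHAR:
  "of_nat i = (of_nat j :: 'a::ring_1) \<longleftrightarrow> [i = j] (mod CHAR('a))"
proof -
  have *: "of_nat i = (of_nat j :: 'a) \<longleftrightarrow> [i = j] (mod CHAR('a))" if "i \<le> j" for i j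
  proof -
    have "of_nat i = (of_nat j :: 'a) \<longleftrightarrow> of_nat (j - i) = (0 :: 'a)"
      using that by (auto simp: of_nat_diff)
    also have "\<dots> \<longleftrightarrow> CHAR('a) dvd j - i" by (rule of_nat_eq_0_iff_char_dvd)
    also have "\<dots> \<longleftrightarrow> [i = j] (mod CHAR('a))"
      using that by (metis cong_altdef_nat cong_sym_eq)
    finally show ?thesis .
  qed
  show ?thesis
    using *[of i j] *[of j i] by (metis cong_sym_eq nat_le_linear)
qed

lemma add_power_CHAR:
  fixes x y :: "'a::comm_ring_1"
  assumes "prime CHAR('a)"
  shows "(x + y) ^ CHAR('a) = x ^ CHAR('a) + y ^ CHAR('a)"
proof -
  let ?p = "CHAR('a)"
  have p0: "?p > 0" using assms prime_gt_0_nat by blast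
  have "(x + y) ^ ?p = (\<Sum>k\<le>?p. of_nat (?p choose k) * x ^ k * y ^ (?p - k))"
    by (rule binomial_ring)
  also have "\<dots> = (\<Sum>k\<in>{0, ?p}. of_nat (?p choose k) * x ^ k * y ^ (?p - k))"
  proof (rule sum.mono_neutral_right)
    show "\<forall>k\<in>{..?p} - {0, ?p}. of_nat (?p choose k) * x ^ k * y ^ (?p - k) = 0"
    proof
      fix k assume "k \<in> {..?p} - {0, ?p}"
      then have "?p dvd (?p choose k)"
        using assms p0 by (intro dvd_choose_prime) auto
      then have "of_nat (?p choose k) = (0 :: 'a)"
        by (simp add: of_nat_eq_0_iff_char_dvd)
      then show "of_nat (?p choose k) * x ^ k * y ^ (?p - k) = 0" by simp
    qed
  qed auto
  finally show ?thesis using p0 by simp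
qed

lemma add_power_CHAR_power:
  fixes x y :: "'a::comm_ring_1"
  assumes "prime CHAR('a)"
  shows "(x + y) ^ (CHAR('a) ^ i) = x ^ (CHAR('a) ^ i) + y ^ (CHAR('a) ^ i)"
proof (induction i)
  case (Suc i)
  then show ?case
    by (simp only: power_Suc2 power_mult add_power_CHAR[OF assms])
qed simp

lemma sum_power_CHAR_power:
  fixes f :: "'b \<Rightarrow> 'a::comm_ring_1"
  assumes "prime CHAR('a)"
  shows "(\<Sum>j\<in>J. f j) ^ (CHAR('a) ^ i) = (\<Sum>j\<in>J. f j ^ (CHAR('a) ^ i))"
proof (induction J rule: infinite_finite_induct)
  case (insert j J)
  then show ?case by (simp add: add_power_CHAR_power[OF assms])
qed (use assms prime_gt_0_nat in \<open>auto simp: power_0_left\<close>)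

text \<open>X^n - X has at most \<open>n\<close> roots, so \<open>n\<close> known roots are all of
  them. This identifies both the prime field and the embedded field F_q as fixed points of a power
  map.\<close>

lemma power_fixpoints_eq:
  fixes S :: "'a::idom set"
  assumes "n \<ge> 2" "card S = n" "\<And>x. x \<in> S \<Longrightarrow> x ^ n = x"
  shows "{x. x ^ n = x} = S"
proof -
  let ?P = "monom 1 n - monom 1 1 :: 'a poly"
  have c: "coeff ?P n = 1" using assms(1) by simp
  then have P0: "?P \<noteq> 0" by (metis coeff_0 zero_neq_one)
  have roots: "{x. poly ?P x = 0} = {x. x ^ n = x}" by (auto simp: poly_monom)
  have "degree ?P \<le> n" using assms(1) by (intro degree_diff_le) (auto intro: order.trans[OF degree_monom_le])
  then have "card {x::'a. x ^ n = x} \<le> n"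
    using card_poly_roots_bound[OF P0] roots by simp
  moreover have "finite {x::'a. x ^ n = x}"
    using poly_roots_finite[OF P0] roots by simp
  moreover have "S \<subseteq> {x. x ^ n = x}" using assms(3) by blast
  ultimately show ?thesis using assms(2) by (metis card_seteq)
qed

text \<open>The trace polynomial is nonzero of degree at most p^(k-1), too small to vanish on p^k
  elements. This gives nontriviality of the additive characters of both fields.\<close>

lemma additive_power_sum_not_all_zero:
  assumes "prime p" "CARD('a::{field,finite}) = p ^ k"
  shows "\<exists>c::'a. (\<Sum>i<k. c ^ (p ^ i)) \<noteq> 0"
proof (rule ccontr)
  let ?P = "(\<Sum>i<k. monom 1 (p ^ i)) :: 'a poly"
  assume "\<nexists>c::'a. (\<Sum>i<k. c ^ (p ^ i)) \<noteq> 0"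
  then have roots: "{x. poly ?P x = 0} = UNIV" by (auto simp: poly_sum poly_monom)
  have p2: "p \<ge> 2" using assms(1) prime_ge_2_nat by blast
  have "k > 0"
  proof (rule ccontr)
    assume "\<not> 0 < k"
    then have "CARD('a) = 1" using assms(2) by simp
    then show False
      by (metis card_1_singletonE UNIV_I singletonD zero_neq_one)
  qed
  \<comment> \<open>Only the summand \<open>i = 0\<close> contributes to the linear coefficient, as
    p^i = 1 forces i = 0; this keeps the polynomial from being zero.\<close>
  have "coeff ?P 1 = (\<Sum>i<k. if i = 0 then 1 else 0)"
    unfolding coeff_sum using p2 by (intro sum.cong) auto
  then have P0: "?P \<noteq> 0" using \<open>k > 0\<close> by (auto simp: sum.delta')
  have "degree ?P \<le> p ^ (k - 1)"
  proof (rule degree_sum_le)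
    fix i assume "i \<in> {..<k}"
    then have "p ^ i \<le> p ^ (k - 1)" using p2 by (intro power_increasing) auto
    then show "degree (monom (1::'a) (p ^ i)) \<le> p ^ (k - 1)"
      by (rule order.trans[OF degree_monom_le])
  qed auto
  then have "CARD('a) \<le> p ^ (k - 1)"
    using card_poly_roots_bound[OF P0] roots by simp
  moreover have "p ^ (k - 1) < p ^ k"
    using p2 \<open>k > 0\<close> by (intro power_strict_increasing) auto
  ultimately show False using assms(2) by simp
qed

section \<open>The canonical additive character\<close>

context
  fixes p k :: nat
  assumes p: "prime p" and card: "CARD('a::{field,finite}) = p ^ k"
begin

lemma CHAR_p: "CHAR('a) = p"
  using CHAR_eq_prime[OF p card] .

lemma range_of_nat_eq: "{x::'a. x ^ p = x} = of_nat ` {..<p}"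
proof (rule power_fixpoints_eq)
  show "2 \<le> p" using p prime_ge_2_nat by blast
  have "inj_on (of_nat :: nat \<Rightarrow> 'a) {..<p}"
    by (auto simp: inj_on_def of_nat_eq_iff_cong_CHAR CHAR_p cong_def)
  then show "card (of_nat ` {..<p} :: 'a set) = p" by (simp add: card_image)
  have "(of_nat j :: 'a) ^ p = of_nat j" for j
  proof (induction j)
    case (Suc j)
    then show ?case using add_power_CHAR[of 1 "of_nat j :: 'a"] p CHAR_p by simp
  qed (use p prime_gt_0_nat in \<open>auto simp: power_0_left\<close>)
  then show "x ^ p = x" if "x \<in> of_nat ` {..<p}" for x :: 'a using that by auto
qed

text \<open>\<open>abs_trace\<close> is a definite description. Existence: the p-th power map
  rotates the conjugates, so their sum is fixed and lies in the prime field. Uniqueness: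
  representatives below \<open>p\<close> are incongruent modulo the characteristic.\<close>

lemma of_nat_abs_trace: "of_nat (abs_trace p k c) = (\<Sum>i<k. (c::'a) ^ (p ^ i))"
  and abs_trace_less: "abs_trace p k (c::'a) < p"
proof -
  let ?T = "\<Sum>i<k. c ^ (p ^ i)"
  have "?T ^ p = (\<Sum>i<k. c ^ (p ^ Suc i))"
    using sum_power_CHAR_power[of "\<lambda>i. c ^ (p ^ i)" "{..<k}" 1] p CHAR_p
    by (simp flip: power_mult add: mult.commute)
  also have "\<dots> = ?T"
  proof (cases k)
    case (Suc l)
    have "c ^ (p ^ Suc l) = c" using finite_field_power_card[of c] card Suc by simp
    moreover have "(\<Sum>i<Suc l. c ^ (p ^ i)) = c + (\<Sum>i<l. c ^ (p ^ Suc i))"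
      by (subst sum.lessThan_Suc_shift) simp
    ultimately show ?thesis unfolding Suc by simp
  qed simp
  finally have "?T \<in> of_nat ` {..<p}" using range_of_nat_eq by blast
  then obtain j where j: "j < p" "of_nat j = ?T" by auto
  have "abs_trace p k c < p \<and> of_nat (abs_trace p k c) = ?T"
    unfolding abs_trace_def
  proof (rule theI)
    show "j < p \<and> of_nat j = ?T" using j by simp
    fix i assume i: "i < p \<and> of_nat i = ?T"
    then have "[i = j] (mod p)" using j of_nat_eq_iff_cong_CHAR[of i j, where 'a='a] CHAR_p by simp
    then show "i = j" using i j by (simp add: cong_def)
  qed
  then show "of_nat (abs_trace p k c) = ?T" "abs_trace p k c < p" by auto
qed

lemma add_char_power: "add_char p k (c::'a) = exp (2 * of_real pi * \<i> / of_nat p) ^ abs_trace p k c"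
  by (simp add: add_char_def flip: exp_of_nat_mult) (simp add: mult_ac)

lemma root_of_unity_cong:
  assumes "[i = j] (mod p)"
  shows "exp (2 * of_real pi * \<i> / of_nat p) ^ i = exp (2 * of_real pi * \<i> / of_nat p) ^ j"
proof -
  let ?z = "exp (2 * complex_of_real pi * \<i> / of_nat p)"
  have "?z ^ p = exp (2 * of_real pi * \<i>)"
    using p prime_gt_0_nat by (simp flip: exp_of_nat_mult)
  then have "?z ^ p = 1" by (simp add: exp_eq_polar)
  then have "?z ^ l = ?z ^ (l mod p)" for l
    by (metis (no_types, lifting) mult_1 mult_div_mod_eq power_add power_mult power_one)
  then show ?thesis using assms by (metis cong_def)
qed

lemma add_char_add: "add_char p k (x + y :: 'a) = add_char p k x * add_char p k y"
proof -
  have "(of_nat (abs_trace p k (x + y)) :: 'a) = of_nat (abs_trace p k x + abs_trace p k y)"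
    using p by (simp add: of_nat_abs_trace add_power_CHAR_power[where 'a='a, unfolded CHAR_p] sum.distrib)
  then have "[abs_trace p k (x + y) = abs_trace p k x + abs_trace p k y] (mod p)"
    by (simp only: of_nat_eq_iff_cong_CHAR CHAR_p)
  then show ?thesis
    unfolding add_char_power power_add[symmetric] by (rule root_of_unity_cong)
qed

text \<open>The exponent lies below \<open>p\<close>, so the root of unity is 1 only for exponent 0.
  Triviality of the character thus becomes a statement on power sums, which can be compared across
  the two fields.\<close>

lemma add_char_eq_1_iff: "add_char p k (c::'a) = 1 \<longleftrightarrow> (\<Sum>i<k. c ^ (p ^ i)) = 0"
proof -
  let ?j = "abs_trace p k c"
  have p0: "p > 0" using p prime_gt_0_nat by blast
  have "add_char p k c = cis (2 * pi * real ?j / real p)"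
    unfolding add_char_def cis_conv_exp by (simp add: mult_ac)
  moreover have "cis (2 * pi * real ?j / real p) = 1 \<longleftrightarrow> ?j = 0"
  proof
    assume "cis (2 * pi * real ?j / real p) = 1"
    then have "cos (2 * pi * real ?j / real p) = 1" by (metis cis.sel(1) one_complex.sel(1))
    then obtain z :: int where "2 * pi * real ?j / real p = of_int z * 2 * pi"
      unfolding cos_one_2pi_int by blast
    then have "real ?j = of_int z * real p" using p0 by (simp add: field_simps)
    then have "int ?j = z * int p" by (metis of_int_eq_iff of_int_mult of_int_of_nat_eq)
    then have "int p dvd int ?j" by simp
    then have "p dvd ?j" by (simp only: int_dvd_int_iff)
    then show "?j = 0" using abs_trace_less by (meson dvd_imp_le leD neq0_conv)
  qed auto
  moreover have "?j = 0 \<longleftrightarrow> (of_nat ?j :: 'a) = 0"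
    using abs_trace_less[of c] by (auto simp: of_nat_eq_0_iff_char_dvd CHAR_p dest: dvd_imp_le)
  ultimately show ?thesis by (simp add: of_nat_abs_trace)
qed

end

text \<open>Translating the summation variable by \<open>c\<close> multiplies the sum by
  \<open>\<psi> c\<close>, which is not 1.\<close>

lemma sum_add_hom_eq_0:
  fixes \<psi> :: "'a::{ab_group_add,finite} \<Rightarrow> 'b::idom"
  assumes "\<And>x y. \<psi> (x + y) = \<psi> x * \<psi> y" "\<psi> c \<noteq> 1"
  shows "(\<Sum>x\<in>UNIV. \<psi> x) = 0"
proof -
  have "(\<Sum>x\<in>UNIV. \<psi> x) = (\<Sum>x\<in>UNIV. \<psi> (c + x))"
    by (rule sum.reindex_bij_witness[of _ "\<lambda>x. c + x" "\<lambda>x. x - c"]) auto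
  also have "\<dots> = \<psi> c * (\<Sum>x\<in>UNIV. \<psi> x)"
    by (simp add: assms(1) sum_distrib_left)
  finally show ?thesis using assms(2) by (metis mult_cancel_right1)
qed

section \<open>Sums of periodic functions\<close>

lemma sum_lessThan_mult:
  fixes f :: "nat \<Rightarrow> 'b::comm_monoid_add"
  shows "(\<Sum>i<L * P. f i) = (\<Sum>l<L. \<Sum>i<P. f (l * P + i))"
proof -
  have "sum f {l * P..<l * P + P} = (\<Sum>i<P. f (l * P + i))" for l
    by (rule sum.reindex_bij_witness[of _ "\<lambda>i. l * P + i" "\<lambda>i. i - l * P"]) auto
  then show ?thesis by (simp flip: sum.nat_group)
qed

lemma sum_periodic_mult:
  fixes F :: "int \<Rightarrow> 'b::comm_semiring_1"
  assumes "\<And>i j. [i = j] (mod int P) \<Longrightarrow> F i = F j"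
  shows "(\<Sum>i<L * P. F (int i)) = of_nat L * (\<Sum>i<P. F (int i))"
proof -
  have "F (int (l * P + i)) = F (int i)" for l i
    by (rule assms) (simp add: cong_def)
  then show ?thesis by (simp add: sum_lessThan_mult)
qed

lemma sum_periodic_coprime:
  fixes F :: "int \<Rightarrow> 'b::comm_monoid_add"
  assumes per: "\<And>i j. [i = j] (mod int P) \<Longrightarrow> F i = F j" and "coprime b (int P)" "P > 0"
  shows "(\<Sum>i<P. F (b * int i)) = (\<Sum>i<P. F (int i))"
proof -
  let ?h = "\<lambda>i. nat ((b * int i) mod int P)"
  have sub: "?h ` {..<P} \<subseteq> {..<P}"
    using assms(3) by (auto simp: nat_less_iff)
  have inj: "inj_on ?h {..<P}"
  proof (rule inj_onI)
    fix i j assume ij: "i \<in> {..<P}" "j \<in> {..<P}" "?h i = ?h j"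
    then have "(b * int i) mod int P = (b * int j) mod int P"
      using assms(3) by (simp add: eq_nat_nat_iff)
    then have "[b * int i = b * int j] (mod int P)" by (simp add: cong_def)
    then have "[int i = int j] (mod int P)"
      using assms(2) by (simp add: cong_mult_lcancel)
    then show "i = j" using ij by (simp add: cong_int_iff cong_def)
  qed
  have "bij_betw ?h {..<P} {..<P}"
    using endo_inj_surj[OF _ sub inj] inj by (auto simp: bij_betw_def)
  then have "(\<Sum>i<P. F (int i)) = (\<Sum>i<P. F (int (?h i)))"
    by (rule sum.reindex_bij_betw[symmetric])
  also have "\<dots> = (\<Sum>i<P. F (b * int i))"
    using assms(3) by (intro sum.cong refl per) (auto simp: cong_def)
  finally show ?thesis by simp
qed

text \<open>Since \<open>P\<close> divides \<open>b * L\<close>, the map i to F(b i) has period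
  \<open>L\<close>, so \<open>e\<close> copies of the progression fill the length \<open>Q\<close>.
  The same length consists of \<open>K\<close> full periods of \<open>F\<close>, on each of which
  the unit \<open>b\<close> only permutes the residues.\<close>

lemma sum_arithmetic_progression:
  fixes F :: "int \<Rightarrow> 'b::comm_semiring_1"
  assumes per: "\<And>i j. [i = j] (mod int P) \<Longrightarrow> F i = F j"
    and "coprime b (int P)" "P > 0" "Q = e * L" "Q = K * P" "int P dvd b * int L"
  shows "of_nat e * (\<Sum>i<L. F (b * int i)) = of_nat K * (\<Sum>i<P. F (int i))"
proof -
  have "of_nat e * (\<Sum>i<L. F (b * int i)) = (\<Sum>i<e * L. F (b * int i))"
  proof (rule sum_periodic_mult[symmetric])
    fix i j assume "[i = j] (mod int L)"
    then have "b * int L dvd b * (i - j)" by (simp add: cong_iff_dvd_diff mult_dvd_mono)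
    then have "int P dvd b * (i - j)" using assms(6) dvd_trans by blast
    then show "F (b * i) = F (b * j)"
      by (intro per) (simp add: cong_iff_dvd_diff right_diff_distrib)
  qed
  also have "\<dots> = (\<Sum>i<K * P. F (b * int i))" using assms by metis
  also have "\<dots> = of_nat K * (\<Sum>i<P. F (b * int i))"
    by (rule sum_periodic_mult) (intro per cong_mult cong_refl)
  also have "(\<Sum>i<P. F (b * int i)) = (\<Sum>i<P. F (int i))"
    using assms by (intro sum_periodic_coprime per)
  finally show ?thesis .
qed

section \<open>Squares and quadratic Gaussian periods\<close>

lemma power_CARD_diff_1:
  fixes x :: "'a::{field,finite}"
  assumes "x \<noteq> 0"
  shows "x ^ (CARD('a) - 1) = 1"
proof -
  have "CARD('a) > 0" by simp
  then have "x * x ^ (CARD('a) - 1) = x * 1"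
    using finite_field_power_card[of x] by (metis Suc_diff_1 mult.right_neutral power_Suc)
  then show ?thesis using assms by simp
qed

locale cyclic_field =
  fixes \<gamma> :: "'a::{field,finite}"
  assumes gen: "mult_generator \<gamma>"
begin

lemma gen_nonzero: "\<gamma> \<noteq> 0"
proof
  assume "\<gamma> = 0"
  then have "\<gamma> powi 0 \<in> range (\<lambda>k::int. \<gamma> powi k)" "\<gamma> powi 1 \<in> range (\<lambda>k::int. \<gamma> powi k)" by blast+
  with \<open>\<gamma> = 0\<close> gen show False unfolding mult_generator_def by auto
qed

lemma powi_mod: "\<gamma> powi (i mod int (CARD('a) - 1)) = \<gamma> powi i"
proof -
  let ?R = "int (CARD('a) - 1)"
  have "\<gamma> powi i = \<gamma> powi (?R * (i div ?R) + i mod ?R)" by simp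
  also have "\<dots> = (\<gamma> powi ?R) powi (i div ?R) * \<gamma> powi (i mod ?R)"
    using gen_nonzero by (simp only: power_int_add power_int_mult simp_thms)
  also have "\<gamma> powi ?R = 1"
    using power_CARD_diff_1[OF gen_nonzero] by (simp only: power_int_of_nat)
  finally show ?thesis by simp
qed

lemma CARD_ge_2: "CARD('a) \<ge> 2"
proof -
  have "card {0, 1 :: 'a} \<le> CARD('a)" by (rule card_mono) auto
  then show ?thesis by simp
qed

text \<open>Reducing exponents modulo r-1 gives surjectivity; both sides have r-1 elements, so
  injectivity follows by counting.\<close>

lemma bij_betw_powers: "bij_betw (\<lambda>i. \<gamma> ^ i) {..<CARD('a) - 1} (UNIV - {0})"
proof -
  let ?R = "CARD('a) - 1"
  have "UNIV - {0} \<subseteq> (\<lambda>i. \<gamma> ^ i) ` {..<?R}"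
  proof
    fix x :: 'a assume "x \<in> UNIV - {0}"
    then obtain k :: int where "x = \<gamma> powi k" using gen unfolding mult_generator_def by blast
    also have "\<dots> = \<gamma> powi (k mod int ?R)" by (simp only: powi_mod)
    also have "\<dots> = \<gamma> ^ nat (k mod int ?R)"
      using CARD_ge_2 by (simp add: power_int_def)
    finally show "x \<in> (\<lambda>i. \<gamma> ^ i) ` {..<?R}"
      using CARD_ge_2 by (auto simp: nat_less_iff)
  qed
  then have im: "(\<lambda>i. \<gamma> ^ i) ` {..<?R} = UNIV - {0}" using gen_nonzero by auto
  moreover have "card (UNIV - {0 :: 'a}) = ?R" by simp
  ultimately show ?thesis by (simp add: bij_betw_def eq_card_imp_inj_on)
qed

lemma powi_eq_iff: "\<gamma> powi i = \<gamma> powi j \<longleftrightarrow> [i = j] (mod int (CARD('a) - 1))"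
proof
  let ?R = "int (CARD('a) - 1)"
  have pos: "?R > 0" using CARD_ge_2 by simp
  have nn: "\<gamma> powi i = \<gamma> ^ nat (i mod ?R)" for i
    using powi_mod[of i] pos by (metis int_nat_eq power_int_of_nat pos_mod_sign)
  have "nat (i mod ?R) < CARD('a) - 1" for i using pos by (simp add: nat_less_iff)
  moreover assume "\<gamma> powi i = \<gamma> powi j"
  ultimately have "nat (i mod ?R) = nat (j mod ?R)"
    using bij_betw_powers unfolding bij_betw_def inj_on_def nn by blast
  then show "[i = j] (mod ?R)" using pos by (simp add: cong_def eq_nat_nat_iff)
next
  assume "[i = j] (mod int (CARD('a) - 1))"
  then show "\<gamma> powi i = \<gamma> powi j" by (metis cong_def powi_mod)
qed

lemma nonzero_powi:
  fixes x :: 'a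
  assumes "x \<noteq> 0"
  obtains k where "x = \<gamma> powi k"
  using assms gen unfolding mult_generator_def by blast

end

locale odd_cyclic_field = cyclic_field \<gamma> for \<gamma> :: "'a::{field,finite}" +
  assumes odd_card: "odd CARD('a)"
begin

text \<open>Exponents are determined modulo r-1, which is even, so their parity is well
  defined.\<close>

lemma is_square_powi_iff: "is_square (\<gamma> powi k) \<longleftrightarrow> even k"
proof
  assume "is_square (\<gamma> powi k)"
  then obtain y where y: "\<gamma> powi k = y ^ 2" by (rule is_nth_powerE)
  then have "y \<noteq> 0" using gen_nonzero by auto
  then obtain l where "y = \<gamma> powi l" by (rule nonzero_powi)
  then have "\<gamma> powi k = \<gamma> powi (2 * l)" using y gen_nonzero
    by (metis mult.commute power_int_mult power_int_numeral)
  then have "int (CARD('a) - 1) dvd k - 2 * l"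
    by (simp only: powi_eq_iff cong_iff_dvd_diff)
  moreover have "2 dvd int (CARD('a) - 1)" using odd_card by simp
  ultimately have "2 dvd k - 2 * l" using dvd_trans by blast
  then show "even k" by simp
next
  assume "even k"
  then obtain l where "k = 2 * l" by blast
  then have "\<gamma> powi k = (\<gamma> powi l) ^ 2" using gen_nonzero
    by (metis mult.commute power_int_mult power_int_numeral)
  then show "is_square (\<gamma> powi k)" by (rule is_nth_powerI)
qed

lemma is_square_mult_iff:
  fixes x y :: 'a
  assumes "x \<noteq> 0" "y \<noteq> 0"
  shows "is_square (x * y) \<longleftrightarrow> (is_square x \<longleftrightarrow> is_square y)"
proof -
  obtain k l where "x = \<gamma> powi k" "y = \<gamma> powi l" using assms nonzero_powi by metis
  moreover have "\<gamma> powi k * \<gamma> powi l = \<gamma> powi (k + l)" using gen_nonzero by (simp add: power_int_add)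
  ultimately show ?thesis by (simp add: is_square_powi_iff)
qed

lemma is_square_divide_iff:
  fixes x y :: 'a
  assumes "x \<noteq> 0" "y \<noteq> 0"
  shows "is_square (x / y) \<longleftrightarrow> (is_square x \<longleftrightarrow> is_square y)"
  using is_square_mult_iff[of "x / y" y] assms by auto

text \<open>The boolean index plays the role of the quadratic character: multiplication by
  \<open>c\<close> sends class \<open>b\<close> to class \<open>b = is_square c\<close>, equality of
  booleans being the product of signs.\<close>

definition sq_class :: "bool \<Rightarrow> 'a set" where
  "sq_class b = {x. x \<noteq> 0 \<and> is_square x = b}"

lemma bij_betw_sq_class_mult:
  fixes c :: 'a
  assumes "c \<noteq> 0"
  shows "bij_betw (\<lambda>x. c * x) (sq_class b) (sq_class (b = is_square c))"
  by (rule bij_betw_byWitness[where f' = "\<lambda>x. x / c"])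
    (use assms in \<open>auto simp: sq_class_def is_square_mult_iff is_square_divide_iff\<close>)

text \<open>Links sums over the group of squares to sums over exponents, where periodicity arguments
  apply.\<close>

lemma sum_sq_class_True:
  "(\<Sum>x\<in>sq_class True. f x) = (\<Sum>i<(CARD('a) - 1) div 2. f (\<gamma> powi (2 * int i)))"
proof -
  have "bij_betw (\<lambda>i. \<gamma> powi (2 * int i)) {..<(CARD('a) - 1) div 2} (sq_class True)"
  proof (rule bij_betw_imageI)
    show "inj_on (\<lambda>i. \<gamma> powi (2 * int i)) {..<(CARD('a) - 1) div 2}"
    proof (rule inj_onI)
      fix i j assume ij: "i \<in> {..<(CARD('a) - 1) div 2}" "j \<in> {..<(CARD('a) - 1) div 2}"
        and eq: "\<gamma> powi (2 * int i) = \<gamma> powi (2 * int j)"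
      from eq have "[int (2 * i) = int (2 * j)] (mod int (CARD('a) - 1))"
        by (simp add: powi_eq_iff)
      then have "[2 * i = 2 * j] (mod (CARD('a) - 1))" by (simp only: cong_int_iff)
      moreover have "2 * i < CARD('a) - 1" "2 * j < CARD('a) - 1" using ij by auto
      ultimately show "i = j" by (simp add: cong_def)
    qed
    show "(\<lambda>i. \<gamma> powi (2 * int i)) ` {..<(CARD('a) - 1) div 2} = sq_class True"
    proof (intro equalityI subsetI)
      fix x assume "x \<in> sq_class True"
      then have x: "x \<noteq> 0" "is_square x" by (auto simp: sq_class_def)
      then obtain k where k: "k < CARD('a) - 1" "x = \<gamma> ^ k"
        using bij_betw_powers unfolding bij_betw_def by blast
      then have "even (int k)" using x is_square_powi_iff[of "int k"] by simp
      then obtain i where "k = 2 * i" by auto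
      moreover have "\<gamma> powi (2 * int i) = \<gamma> powi int (2 * i)" by simp
      moreover have "even (CARD('a) - 1)" using odd_card by simp
      ultimately show "x \<in> (\<lambda>i. \<gamma> powi (2 * int i)) ` {..<(CARD('a) - 1) div 2}"
        using k by (intro image_eqI[of _ _ i]) (simp_all add: power_int_of_nat less_mult_imp_div_less del: of_nat_mult, presburger)
    qed (use gen_nonzero in \<open>auto simp: sq_class_def is_square_powi_iff\<close>)
  qed
  then show ?thesis by (rule sum.reindex_bij_betw[symmetric])
qed

lemma card_sq_class: "card (sq_class b) = (CARD('a) - 1) div 2"
proof -
  have T: "card (sq_class True) = (CARD('a) - 1) div 2"
    using sum_sq_class_True[of "\<lambda>_. 1 :: nat"] by simp
  have "\<not> is_square \<gamma>" using is_square_powi_iff[of 1] by simp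
  then have "card (sq_class True) = card (sq_class False)"
    using bij_betw_same_card[OF bij_betw_sq_class_mult[of \<gamma> True]] gen_nonzero by simp
  with T show ?thesis by (cases b) auto
qed

end

text \<open>The character is kept abstract here; the trace enters again only when
  \<open>\<psi>\<close> is summed over lines of the small field.\<close>

locale quadratic_periods = odd_cyclic_field \<gamma> for \<gamma> :: "'a::{field,finite}" +
  fixes \<psi> :: "'a \<Rightarrow> complex"
  assumes char_0: "\<psi> 0 = 1"
    and char_add: "\<psi> (x + y) = \<psi> x * \<psi> y"
    and char_nontrivial: "\<exists>c. \<psi> c \<noteq> 1"
begin

definition eta :: "bool \<Rightarrow> complex" where
  "eta b = (\<Sum>x\<in>sq_class b. \<psi> x)"

lemma char_sum: "finite A \<Longrightarrow> \<psi> (\<Sum>x\<in>A. f x) = (\<Prod>x\<in>A. \<psi> (f x))"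
  by (induction A rule: finite_induct) (auto simp: char_0 char_add)

lemma sum_char: "(\<Sum>x\<in>UNIV. \<psi> x) = 0"
  using sum_add_hom_eq_0[of \<psi>] char_add char_nontrivial by blast

lemma sum_char_mult: "(\<Sum>c\<in>UNIV. \<psi> (c * y)) = (if y = 0 then of_nat CARD('a) else 0)"
proof (cases "y = 0")
  case False
  have "(\<Sum>c\<in>UNIV. \<psi> (c * y)) = (\<Sum>c\<in>UNIV. \<psi> c)"
    by (rule sum.reindex_bij_witness[of _ "\<lambda>c. c / y" "\<lambda>c. c * y"]) (use False in auto)
  then show ?thesis using False sum_char by simp
qed (simp add: char_0)

lemma sum_nonzero_split:
  fixes f :: "'a \<Rightarrow> 'b::comm_monoid_add"
  shows "(\<Sum>x\<in>UNIV. f x) = f 0 + ((\<Sum>x\<in>sq_class True. f x) + (\<Sum>x\<in>sq_class False. f x))"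
proof -
  have "UNIV = insert 0 (sq_class True \<union> sq_class False)" by (auto simp: sq_class_def)
  then have "(\<Sum>x\<in>UNIV. f x) = (\<Sum>x\<in>insert 0 (sq_class True \<union> sq_class False). f x)" by simp
  also have "\<dots> = f 0 + (\<Sum>x\<in>sq_class True \<union> sq_class False. f x)"
    by (rule sum.insert) (auto simp: sq_class_def)
  also have "(\<Sum>x\<in>sq_class True \<union> sq_class False. f x) =
      (\<Sum>x\<in>sq_class True. f x) + (\<Sum>x\<in>sq_class False. f x)"
    by (rule sum.union_disjoint) (auto simp: sq_class_def)
  finally show ?thesis .
qed

lemma eta_False: "eta False = - 1 - eta True"
  using sum_nonzero_split[of \<psi>] sum_char by (simp add: eta_def char_0 algebra_simps eq_neg_iff_add_eq_0)

lemma sum_sq_class_char: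
  "(\<Sum>x\<in>sq_class b. \<psi> (c * x)) =
     (if c = 0 then of_nat ((CARD('a) - 1) div 2) else eta (b = is_square c))"
proof (cases "c = 0")
  case False
  then show ?thesis
    using sum.reindex_bij_betw[OF bij_betw_sq_class_mult[OF False, of b], of \<psi>] by (simp add: eta_def)
qed (simp add: char_0 card_sq_class)

text \<open>
  With the Gauss sum \<open>G = \<Sum>x. \<chi> x * \<psi> x\<close> of the quadratic character \<open>\<chi>\<close>, one has
  \<open>\<chi> c * G = \<Sum>x. \<chi> x * \<psi> (c * x)\<close>; multiplying by \<open>\<psi> c\<close> and summing over \<open>c\<close> gives
  \<open>G\<^sup>2 = \<chi> (- 1) * r\<close>.
\<close>

lemma eta_diff_square:
  assumes "is_square (- 1 :: 'a)"
  shows "(eta True - eta False)\<^sup>2 = of_nat CARD('a)"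
proof -
  define \<chi> :: "'a \<Rightarrow> complex" where "\<chi> x = (if x = 0 then 0 else if is_square x then 1 else - 1)" for x
  define G where "G = eta True - eta False"
  have split: "(\<Sum>x\<in>UNIV. \<chi> x * f x) = (\<Sum>x\<in>sq_class True. f x) - (\<Sum>x\<in>sq_class False. f x)"
    for f :: "'a \<Rightarrow> complex"
  proof -
    have "(\<Sum>x\<in>sq_class True. \<chi> x * f x) = (\<Sum>x\<in>sq_class True. f x)"
      by (rule sum.cong) (auto simp: \<chi>_def sq_class_def)
    moreover have "(\<Sum>x\<in>sq_class False. \<chi> x * f x) = (\<Sum>x\<in>sq_class False. - f x)"
      by (rule sum.cong) (auto simp: \<chi>_def sq_class_def)
    moreover have "\<chi> 0 = 0" by (simp add: \<chi>_def)
    ultimately show ?thesis by (simp add: sum_nonzero_split sum_negf)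
  qed
  have tw: "\<chi> c * G = (\<Sum>x\<in>UNIV. \<chi> x * \<psi> (c * x))" for c
    unfolding split sum_sq_class_char by (simp add: \<chi>_def G_def)
  have "G\<^sup>2 = (\<Sum>c\<in>UNIV. \<chi> c * \<psi> c) * G"
    by (simp only: split flip: eta_def) (simp add: G_def power2_eq_square)
  also have "\<dots> = (\<Sum>c\<in>UNIV. \<psi> c * (\<chi> c * G))"
    unfolding sum_distrib_right by (simp add: mult_ac)
  also have "\<dots> = (\<Sum>c\<in>UNIV. \<Sum>x\<in>UNIV. \<chi> x * \<psi> (c * (1 + x)))"
    unfolding tw sum_distrib_left by (simp add: mult_ac distrib_left char_add)
  also have "\<dots> = (\<Sum>x\<in>UNIV. \<chi> x * (\<Sum>c\<in>UNIV. \<psi> (c * (1 + x))))"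
    by (subst sum.swap) (simp add: sum_distrib_left)
  also have "\<dots> = (\<Sum>x\<in>UNIV. if x = - 1 then \<chi> x * of_nat CARD('a) else 0)"
    unfolding sum_char_mult
    by (intro sum.cong refl) (metis add.commute add_eq_0_iff minus_minus mult_zero_right)
  also have "\<dots> = of_nat CARD('a)"
    using assms by (simp add: \<chi>_def)
  finally show ?thesis by (simp add: G_def)
qed

text \<open>The periods have sum -1 and squared difference \<open>r\<close>, which determines them
  up to order. The disjunction is kept because all later formulas are symmetric enough to absorb
  it.\<close>

lemma eta_cases:
  assumes "is_square (- 1 :: 'a)"
  shows "eta True = - (1 - of_real (sqrt CARD('a))) / 2 \<and> eta False = - (1 + of_real (sqrt CARD('a))) / 2 \<or>
    eta True = - (1 + of_real (sqrt CARD('a))) / 2 \<and> eta False = - (1 - of_real (sqrt CARD('a))) / 2"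
proof -
  define z where "z = complex_of_real (sqrt (real CARD('a)))"
  have z2: "z\<^sup>2 = of_nat CARD('a)" by (simp add: z_def flip: of_real_power)
  have "(eta True - eta False)\<^sup>2 = z\<^sup>2"
    using eta_diff_square[OF assms] z2 by simp
  then have "eta True - eta False = z \<or> eta True - eta False = - z" by (simp add: power2_eq_iff)
  then show ?thesis
    unfolding z_def[symmetric]
  proof (rule disj_forward)
    assume "eta True - eta False = z"
    then have "2 * eta True = z - 1" by (simp add: eta_False eq_diff_eq)
    then have 1: "eta True = (z - 1) / 2" by (simp add: field_simps)
    show "eta True = - (1 - z) / 2 \<and> eta False = - (1 + z) / 2"
      unfolding eta_False 1 by (simp add: field_simps)
  next
    assume "eta True - eta False = - z"
    then have "2 * eta True = - z - 1" by (simp add: eta_False) (simp add: algebra_simps)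
    then have 1: "eta True = (- z - 1) / 2" by (simp add: field_simps)
    show "eta True = - (1 + z) / 2 \<and> eta False = - (1 - z) / 2"
      unfolding eta_False 1 by (simp add: field_simps)
  qed
qed

text \<open>The condition on the sum is detected by averaging \<open>\<psi> (c * y)\<close> over
  \<open>c\<close>, and the sum over the product set factors. \<open>c = 0\<close> gives the main
  term; any other \<open>c\<close> matters only through its square class, so two products of periods
  occur, each (r-1)/2 times.\<close>

lemma card_zero_sums:
  assumes "finite S"
  shows "of_nat CARD('a) * of_nat (card {w \<in> PiE S (\<lambda>h. sq_class (B h)). (\<Sum>h\<in>S. w h) = 0}) =
    of_nat ((CARD('a) - 1) div 2) ^ card S +
    of_nat ((CARD('a) - 1) div 2) *
      ((\<Prod>h\<in>S. eta (B h)) + (\<Prod>h\<in>S. eta (\<not> B h)))"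
proof -
  let ?P = "PiE S (\<lambda>h. sq_class (B h))" and ?n = "of_nat ((CARD('a) - 1) div 2) :: complex"
  have fin: "finite ?P" using assms by (intro finite_PiE) auto
  have "of_nat CARD('a) * of_nat (card {w \<in> ?P. (\<Sum>h\<in>S. w h) = 0}) =
      (\<Sum>w\<in>?P. if (\<Sum>h\<in>S. w h) = 0 then of_nat CARD('a) else (0::complex))"
    using fin by (simp add: sum.If_cases Int_def mult.commute)
  also have "\<dots> = (\<Sum>w\<in>?P. \<Sum>c\<in>UNIV. \<psi> (c * (\<Sum>h\<in>S. w h)))"
    by (simp add: sum_char_mult)
  also have "\<dots> = (\<Sum>c\<in>UNIV. \<Sum>w\<in>?P. \<Prod>h\<in>S. \<psi> (c * w h))"
    by (subst sum.swap) (simp add: sum_distrib_left char_sum assms)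
  also have "\<dots> = (\<Sum>c\<in>UNIV. \<Prod>h\<in>S. \<Sum>x\<in>sq_class (B h). \<psi> (c * x))"
    by (simp add: prod_sum_PiE assms)
  also have "\<dots> = (\<Sum>c\<in>(UNIV :: 'a set). \<Prod>h\<in>S. if c = 0 then ?n else eta (B h = is_square c))"
    by (simp only: sum_sq_class_char)
  also have "\<dots> = ?n ^ card S + ((\<Sum>c\<in>sq_class True. \<Prod>h\<in>S. eta (B h)) +
      (\<Sum>c\<in>sq_class False. \<Prod>h\<in>S. eta (\<not> B h)))"
    unfolding sum_nonzero_split
    by (intro arg_cong2[where f = "(+)"] sum.cong prod.cong) (auto simp: sq_class_def)
  finally show ?thesis by (simp add: card_sq_class distrib_left)
qed

text \<open>Exchanging the two periods merely exchanges the two products, so both cases of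
  \<open>eta_cases\<close> give the same value. Nonemptiness of \<open>S\<close> keeps the natural
  exponent \<open>u + v - 1\<close> in \<open>Omega\<close> from truncating.\<close>

lemma card_zero_sums_Omega:
  assumes "finite S" "S \<noteq> {}" "is_square (- 1 :: 'a)"
  shows "real (card {w \<in> PiE S (\<lambda>h. sq_class (B h)). (\<Sum>h\<in>S. w h) = 0}) =
    Omega CARD('a) (card {h \<in> S. B h}) (card {h \<in> S. \<not> B h})"
proof -
  define r where "r = CARD('a)"
  define u where "u = card {h \<in> S. B h}"
  define v where "v = card {h \<in> S. \<not> B h}"
  define z where "z = complex_of_real (sqrt (real r))"
  have r2: "r \<ge> 2" "odd r" using CARD_ge_2 odd_card by (auto simp: r_def)
  have uv: "card S = u + v"
  proof -
    have "S = {h \<in> S. B h} \<union> {h \<in> S. \<not> B h}" by auto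
    then show ?thesis unfolding u_def v_def
      by (metis (no_types, lifting) assms(1) card_Un_disjoint disjoint_iff finite_Un mem_Collect_eq)
  qed
  then have uv1: "u + v \<ge> 1" using assms by (metis One_nat_def Suc_leI card_gt_0_iff)
  have half: "(of_nat ((r - 1) div 2) :: complex) = (of_nat r - 1) / 2"
  proof -
    have "r - 1 = 2 * ((r - 1) div 2)" using r2 by simp
    then have "(of_nat (r - 1) :: complex) = 2 * of_nat ((r - 1) div 2)"
      by (metis of_nat_mult of_nat_numeral)
    then have "(of_nat r - 1 :: complex) = 2 * of_nat ((r - 1) div 2)"
      using r2 by (simp add: of_nat_diff)
    then show ?thesis by simp
  qed
  have pr: "(\<Prod>h\<in>S. eta (B h)) = eta True ^ u * eta False ^ v"
    "(\<Prod>h\<in>S. eta (\<not> B h)) = eta False ^ u * eta True ^ v"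
  proof -
    have "(\<Prod>h\<in>S. f (B h)) = f True ^ u * f False ^ v" for f :: "bool \<Rightarrow> complex"
    proof -
      have "(\<Prod>h\<in>S. f (B h)) = (\<Prod>h\<in>S. if B h then f True else f False)"
        by (rule prod.cong) auto
      also have "\<dots> = f True ^ u * f False ^ v"
        using assms(1) by (simp add: prod.If_cases u_def v_def Int_def Diff_eq)
      finally show ?thesis .
    qed
    from this[of eta] this[of "\<lambda>b. eta (\<not> b)"]
    show "(\<Prod>h\<in>S. eta (B h)) = eta True ^ u * eta False ^ v"
      "(\<Prod>h\<in>S. eta (\<not> B h)) = eta False ^ u * eta True ^ v" by simp_all
  qed
  have "eta True = - (1 - z) / 2 \<and> eta False = - (1 + z) / 2 \<or>
      eta True = - (1 + z) / 2 \<and> eta False = - (1 - z) / 2"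
    using eta_cases[OF assms(3)] by (simp only: z_def r_def)
  then have "(\<Prod>h\<in>S. eta (B h)) + (\<Prod>h\<in>S. eta (\<not> B h)) =
      (- 1) ^ (u + v) / 2 ^ (u + v) *
      ((1 + z) ^ u * (1 - z) ^ v + (1 - z) ^ u * (1 + z) ^ v)"
  proof -
    have *: "(- x / 2) ^ u * (- y / 2) ^ v = (- 1) ^ (u + v) / 2 ^ (u + v) * (x ^ u * y ^ v)" for x y :: complex
    proof -
      have "(- x / 2) ^ u = (- 1) ^ u / 2 ^ u * x ^ u" "(- y / 2) ^ v = (- 1) ^ v / 2 ^ v * y ^ v"
        by (metis mult_minus1 power_divide power_mult_distrib times_divide_eq_left)+
      then show ?thesis by (simp add: power_add)
    qed
    assume "eta True = - (1 - z) / 2 \<and> eta False = - (1 + z) / 2 \<or>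
      eta True = - (1 + z) / 2 \<and> eta False = - (1 - z) / 2"
    then show ?thesis
    proof
      assume "eta True = - (1 - z) / 2 \<and> eta False = - (1 + z) / 2"
      then show ?thesis unfolding pr by (simp only: *) (simp only: add.commute distrib_left)
    next
      assume "eta True = - (1 + z) / 2 \<and> eta False = - (1 - z) / 2"
      then show ?thesis unfolding pr by (simp only: *) (simp only: distrib_left)
    qed
  qed
  with card_zero_sums[OF assms(1), of B]
  have "of_nat r * of_nat (card {w \<in> PiE S (\<lambda>h. sq_class (B h)). (\<Sum>h\<in>S. w h) = 0}) =
     ((of_nat r - 1) / 2) ^ (u + v) + (of_nat r - 1) / 2 * ((- 1) ^ (u + v) / 2 ^ (u + v) *
      ((1 + z) ^ u * (1 - z) ^ v + (1 - z) ^ u * (1 + z) ^ v))"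
    by (simp only: half uv flip: r_def)
  also have "\<dots> = complex_of_real (((real r - 1) / 2) ^ (u + v) + (real r - 1) / 2 * ((- 1) ^ (u + v) / 2 ^ (u + v) *
      ((1 + sqrt r) ^ u * (1 - sqrt r) ^ v + (1 - sqrt r) ^ u * (1 + sqrt r) ^ v)))"
    by (simp add: z_def)
  also have "\<dots> = complex_of_real (real r * Omega r u v)"
  proof -
    obtain w where w: "u + v = Suc w" using uv1 by (cases "u + v") auto
    show ?thesis unfolding Omega_def w using r2
      by (simp add: field_simps)
  qed
  finally have "complex_of_real (real r * real (card {w \<in> PiE S (\<lambda>h. sq_class (B h)). (\<Sum>h\<in>S. w h) = 0}))
      = complex_of_real (real r * Omega r u v)" by simp
  then have "real r * real (card {w \<in> PiE S (\<lambda>h. sq_class (B h)). (\<Sum>h\<in>S. w h) = 0}) = real r * Omega r u v"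
    by (simp only: of_real_eq_iff)
  then show ?thesis using r2 by (simp add: r_def u_def v_def)
qed

end

section \<open>Counting zero sums by support and square pattern\<close>

lemma card_eq_sum_fibres:
  assumes "finite A" "finite Y" "f ` A \<subseteq> Y"
  shows "card A = (\<Sum>y\<in>Y. card {x \<in> A. f x = y})"
  using sum.group[OF assms, of "\<lambda>_. 1 :: nat"] by simp

lemma card_nested_subsets:
  assumes "finite I"
  shows "card {(S, T). T \<subseteq> S \<and> S \<subseteq> I \<and> card S = k \<and> card T = u} = (card I choose k) * (k choose u)"
proof -
  have "{(S, T). T \<subseteq> S \<and> S \<subseteq> I \<and> card S = k \<and> card T = u} =
      (SIGMA S:{S. S \<subseteq> I \<and> card S = k}. {T. T \<subseteq> S \<and> card T = u})" by auto
  also have "card \<dots> = (\<Sum>S\<in>{S. S \<subseteq> I \<and> card S = k}. card {T. T \<subseteq> S \<and> card T = u})"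
    using assms by (intro card_SigmaI) (auto intro: finite_subset[of _ "Pow I"])
  also have "\<dots> = (\<Sum>S\<in>{S. S \<subseteq> I \<and> card S = k}. k choose u)"
    using assms by (intro sum.cong) (auto simp: n_subsets finite_subset)
  finally show ?thesis using assms by (simp add: n_subsets)
qed

text \<open>In the application \<open>I\<close> and \<open>J\<close> are the positions with square
  and nonsquare coefficient, \<open>S\<close> is the support and \<open>T\<close> the part counted
  by the second index of the weight. Choices on \<open>I\<close> and on \<open>J\<close> are
  independent, which yields the four binomials.\<close>

lemma card_nested_subsets_Un:
  assumes "finite I" "finite J" "I \<inter> J = {}"
  shows "card {(S, T). T \<subseteq> S \<and> S \<subseteq> I \<union> J \<and> card (S \<inter> I) = k \<and> card (S \<inter> J) = l \<and>
      card (T \<inter> I) = u \<and> card (T \<inter> J) = v} =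
    (card I choose k) * (k choose u) * ((card J choose l) * (l choose v))"
proof -
  let ?A = "\<lambda>I k u. {(S, T). T \<subseteq> S \<and> S \<subseteq> (I :: 'a set) \<and> card S = k \<and> card T = u}"
  let ?C = "{(S, T). T \<subseteq> S \<and> S \<subseteq> I \<union> J \<and> card (S \<inter> I) = k \<and> card (S \<inter> J) = l \<and>
      card (T \<inter> I) = u \<and> card (T \<inter> J) = v}"
  have split_Un: "(S \<union> S') \<inter> I = S" "(S \<union> S') \<inter> J = S'" if "S \<subseteq> I" "S' \<subseteq> J" for S S'
    using that assms(3) by auto
  have "bij_betw (\<lambda>(S, T). ((S \<inter> I, T \<inter> I), (S \<inter> J, T \<inter> J))) ?C (?A I k u \<times> ?A J l v)"
  proof (rule bij_betw_byWitness[where f' = "\<lambda>((S, T), (S', T')). (S \<union> S', T \<union> T')"], goal_cases)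
    case 1
    show ?case by auto
  next
    case 2
    show ?case
    proof
      fix z assume "z \<in> ?A I k u \<times> ?A J l v"
      then obtain S T S' T' where z: "z = ((S, T), (S', T'))" "T \<subseteq> S" "S \<subseteq> I" "T' \<subseteq> S'" "S' \<subseteq> J" by auto
      then have "T \<subseteq> I" "T' \<subseteq> J" by auto
      then show "(case case z of (x, y) \<Rightarrow> (case x of (S, T) \<Rightarrow> \<lambda>(S', T'). (S \<union> S', T \<union> T')) y of
          (S, T) \<Rightarrow> ((S \<inter> I, T \<inter> I), S \<inter> J, T \<inter> J)) = z"
        using z split_Un[of S S'] split_Un[of T T'] by simp
    qed
  next
    case 3
    show ?case by auto
  next
    case 4
    show ?case
    proof (rule image_subsetI)
      fix z assume "z \<in> ?A I k u \<times> ?A J l v"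
      then obtain S T S' T' where z: "z = ((S, T), (S', T'))" "T \<subseteq> S" "S \<subseteq> I" "card S = k" "card T = u"
        "T' \<subseteq> S'" "S' \<subseteq> J" "card S' = l" "card T' = v" by auto
      then have "T \<subseteq> I" "T' \<subseteq> J" by auto
      then show "(case z of (x, y) \<Rightarrow> (case x of (S, T) \<Rightarrow> \<lambda>(S', T'). (S \<union> S', T \<union> T')) y) \<in> ?C"
        using z split_Un[of S S'] split_Un[of T T'] by auto
    qed
  qed
  then have "card ?C = card (?A I k u \<times> ?A J l v)" by (rule bij_betw_same_card)
  then show ?thesis using assms by (simp add: card_cartesian_product card_nested_subsets)
qed

context quadratic_periods
begin

text \<open>Given \<open>S\<close> and \<open>T\<close>, the square class of \<open>w h\<close> for
  \<open>h\<close> in \<open>S\<close> is forced to be \<open>(h \<in> T) = c h\<close>, and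
  \<open>w\<close> vanishes off \<open>S\<close>. Restriction to \<open>S\<close> therefore reduces
  the count to zero sums with prescribed classes.\<close>

lemma card_zero_sums_pattern:
  fixes c :: "'i \<Rightarrow> bool"
  assumes "finite I" "is_square (- 1 :: 'a)" "T \<subseteq> S" "S \<subseteq> I" "S \<noteq> {}"
  shows "real (card {w \<in> PiE I (\<lambda>_. UNIV :: 'a set). (\<Sum>h\<in>I. w h) = 0 \<and> {h \<in> I. w h \<noteq> 0} = S \<and>
      {h \<in> I. w h \<noteq> 0 \<and> is_square (w h) = c h} = T}) =
    Omega CARD('a) (card {h \<in> S. (h \<in> T) = c h}) (card {h \<in> S. (h \<in> T) \<noteq> c h})"
proof -
  let ?W = "{w \<in> PiE I (\<lambda>_. UNIV :: 'a set). (\<Sum>h\<in>I. w h) = 0 \<and> {h \<in> I. w h \<noteq> 0} = S \<and>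
      {h \<in> I. w h \<noteq> 0 \<and> is_square (w h) = c h} = T}"
  let ?B = "\<lambda>h. (h \<in> T) = c h"
  let ?V = "{w \<in> PiE S (\<lambda>h. sq_class (?B h)). (\<Sum>h\<in>S. w h) = 0}"
  have finS: "finite S" using assms finite_subset by blast
  have sumS: "(\<Sum>h\<in>I. w h) = (\<Sum>h\<in>S. w h)" if "\<And>h. h \<in> I - S \<Longrightarrow> w h = 0" for w :: "'i \<Rightarrow> 'a"
    using assms that by (intro sum.mono_neutral_right) auto
  have "bij_betw (\<lambda>w. restrict w S) ?W ?V"
  proof (rule bij_betw_byWitness[where f' = "\<lambda>w. \<lambda>h\<in>I. if h \<in> S then w h else 0"], goal_cases)
    case 1
    show ?case
    proof
      fix w assume w: "w \<in> ?W"
      show "(\<lambda>h\<in>I. if h \<in> S then restrict w S h else 0) = w"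
        using w by (intro ext) (auto simp: PiE_def extensional_def)
    qed
  next
    case 2
    show ?case
    proof
      fix w assume w: "w \<in> ?V"
      show "restrict (\<lambda>h\<in>I. if h \<in> S then w h else 0) S = w"
        using w assms(4) by (intro ext) (auto simp: PiE_def extensional_def)
    qed
  next
    case 3
    show ?case
    proof (rule image_subsetI)
      fix w assume w: "w \<in> ?W"
      then have "(\<Sum>h\<in>S. w h) = 0" using sumS[of w] by auto
      moreover have "w h \<in> sq_class (?B h)" if "h \<in> S" for h
        using w that assms by (auto simp: sq_class_def)
      ultimately show "restrict w S \<in> ?V" by auto
    qed
  next
    case 4
    show ?case
    proof (rule image_subsetI)
      fix w assume w: "w \<in> ?V"
      let ?w = "\<lambda>h\<in>I. if h \<in> S then w h else 0"
      have cl: "w h \<noteq> 0" "is_square (w h) = ?B h" if "h \<in> S" for h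
        using w that by (auto simp: sq_class_def PiE_def Pi_def)
      have "(\<Sum>h\<in>I. ?w h) = (\<Sum>h\<in>S. ?w h)" by (rule sumS) auto
      also have "\<dots> = (\<Sum>h\<in>S. w h)" using assms(4) by (intro sum.cong) auto
      also have "\<dots> = 0" using w by auto
      finally have "(\<Sum>h\<in>I. ?w h) = 0" .
      moreover have "{h \<in> I. ?w h \<noteq> 0} = S" using cl assms(4) by auto
      moreover have "{h \<in> I. ?w h \<noteq> 0 \<and> is_square (?w h) = c h} = T"
        using cl assms(3,4) by auto
      ultimately show "?w \<in> ?W" by auto
    qed
  qed
  then have "card ?W = card ?V" by (rule bij_betw_same_card)
  then show ?thesis using card_zero_sums_Omega[OF finS assms(5,2), of ?B] by simp
qed

text \<open>\<open>k0\<close> and \<open>u0\<close> are the numbers of support positions and of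
  agreeing positions with \<open>c h\<close> true. The squares among the \<open>w h\<close> are the
  agreeing positions with \<open>c h\<close> true and the disagreeing ones with \<open>c h\<close>
  false: u0 + (k - k0) - (u - u0) of them, the first argument of \<open>Omega\<close>.\<close>

lemma card_zero_sums_profile:
  fixes c :: "'i \<Rightarrow> bool"
  assumes "finite I" "is_square (- 1 :: 'a)" "k \<ge> 1"
  shows "real (card {w \<in> PiE I (\<lambda>_. UNIV :: 'a set). (\<Sum>h\<in>I. w h) = 0 \<and> card {h \<in> I. w h \<noteq> 0} = k \<and>
      card {h \<in> I. w h \<noteq> 0 \<and> is_square (w h) = c h} = u}) =
    (\<Sum>k0=0..k. \<Sum>u0=0..u.
       real (card {h \<in> I. c h} choose k0) * real (card {h \<in> I. \<not> c h} choose (k - k0)) *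
       real (k0 choose u0) * real ((k - k0) choose (u - u0)) *
       Omega CARD('a) (2 * u0 + k - k0 - u) (k0 + u - 2 * u0))"
proof -
  define K where "K w = {h \<in> I. w h \<noteq> 0}" for w :: "'i \<Rightarrow> 'a"
  define U where "U w = {h \<in> I. w h \<noteq> 0 \<and> is_square (w h) = c h}" for w :: "'i \<Rightarrow> 'a"
  define Z where "Z = {w \<in> PiE I (\<lambda>_. UNIV :: 'a set). (\<Sum>h\<in>I. w h) = 0}"
  define I0 where "I0 = {h \<in> I. c h}"
  define I1 where "I1 = {h \<in> I. \<not> c h}"
  have fin: "finite I0" "finite I1" "I0 \<inter> I1 = {}" "I0 \<union> I1 = I"
    using assms(1) by (auto simp: I0_def I1_def)
  have "finite (PiE I (\<lambda>_. UNIV :: 'a set))" using assms(1) by (intro finite_PiE) auto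
  then have finZ: "finite Z" by (simp add: Z_def)
  have finI: "finite S" if "S \<subseteq> I" for S using that assms(1) finite_subset by blast
  have split: "card S = card (S \<inter> I0) + card (S \<inter> I1)" if "S \<subseteq> I" for S
  proof -
    have "card ((S \<inter> I0) \<union> (S \<inter> I1)) = card (S \<inter> I0) + card (S \<inter> I1)"
      using fin by (intro card_Un_disjoint) auto
    moreover have "(S \<inter> I0) \<union> (S \<inter> I1) = S" using that fin by auto
    ultimately show ?thesis by simp
  qed
  have KI: "K w \<subseteq> I" "U w \<subseteq> K w" for w by (auto simp: K_def U_def)
  let ?A = "{w \<in> Z. card (K w) = k \<and> card (U w) = u}"
  define cl where "cl k0 u0 = {(S, T). T \<subseteq> S \<and> S \<subseteq> I0 \<union> I1 \<and> card (S \<inter> I0) = k0 \<and> card (S \<inter> I1) = k - k0 \<and>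
      card (T \<inter> I0) = u0 \<and> card (T \<inter> I1) = u - u0}" for k0 u0
  have fincl: "finite (cl k0 u0)" for k0 u0
    by (rule finite_subset[of _ "Pow I \<times> Pow I"]) (use assms(1) fin in \<open>auto simp: cl_def\<close>)
  have block: "real (card {w \<in> ?A. (card (K w \<inter> I0), card (U w \<inter> I0)) = (k0, u0)}) =
      real (card I0 choose k0) * real (card I1 choose (k - k0)) *
       real (k0 choose u0) * real ((k - k0) choose (u - u0)) *
       Omega CARD('a) (2 * u0 + k - k0 - u) (k0 + u - 2 * u0)"
    if "k0 \<le> k" "u0 \<le> u" for k0 u0
  proof -
    let ?D = "{w \<in> ?A. (card (K w \<inter> I0), card (U w \<inter> I0)) = (k0, u0)}"
    have "(\<lambda>w. (K w, U w)) ` ?D \<subseteq> cl k0 u0"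
      unfolding cl_def using KI split[OF KI(1)] split[OF order.trans[OF KI(2) KI(1)]] fin(4)
      by auto
    then have "card ?D = (\<Sum>y\<in>cl k0 u0. card {w \<in> ?D. (K w, U w) = y})"
      using finZ fincl by (intro card_eq_sum_fibres) auto
    also have "real \<dots> = (\<Sum>y\<in>cl k0 u0. real (card {w \<in> ?D. (K w, U w) = y}))" by simp
    also have "\<dots> = (\<Sum>y\<in>cl k0 u0. Omega CARD('a) (2 * u0 + k - k0 - u) (k0 + u - 2 * u0))"
    proof (rule sum.cong[OF refl])
      fix y assume "y \<in> cl k0 u0"
      then obtain S T where y: "y = (S, T)" "T \<subseteq> S" "S \<subseteq> I" "card (S \<inter> I0) = k0" "card (S \<inter> I1) = k - k0"
        "card (T \<inter> I0) = u0" "card (T \<inter> I1) = u - u0" unfolding cl_def fin(4) by auto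
      have cS: "card S = k" "card T = u" using split[of S] split[of T] y that by auto
      have finST: "finite S" "finite T" using y finI by auto
      have "S \<noteq> {}" using cS assms(3) by auto
      have "{w \<in> ?D. (K w, U w) = y} = {w \<in> PiE I (\<lambda>_. UNIV). (\<Sum>h\<in>I. w h) = 0 \<and> {h \<in> I. w h \<noteq> 0} = S \<and>
          {h \<in> I. w h \<noteq> 0 \<and> is_square (w h) = c h} = T}"
        using y cS by (auto simp: Z_def K_def U_def)
      then have "real (card {w \<in> ?D. (K w, U w) = y}) =
          Omega CARD('a) (card {h \<in> S. (h \<in> T) = c h}) (card {h \<in> S. (h \<in> T) \<noteq> c h})"
        using card_zero_sums_pattern[OF assms(1,2) y(2,3) \<open>S \<noteq> {}\<close>, of c] by simp
      moreover have "card {h \<in> S. (h \<in> T) = c h} = 2 * u0 + k - k0 - u"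
      proof -
        have "{h \<in> S. (h \<in> T) = c h} = (T \<inter> I0) \<union> (S \<inter> I1 - T \<inter> I1)"
          using y by (auto simp: I0_def I1_def)
        also have "card \<dots> = card (T \<inter> I0) + card (S \<inter> I1 - T \<inter> I1)"
          using finST fin by (intro card_Un_disjoint) auto
        also have "card (S \<inter> I1 - T \<inter> I1) = (k - k0) - (u - u0)"
          using y finST by (subst card_Diff_subset) auto
        finally have "card {h \<in> S. (h \<in> T) = c h} = u0 + ((k - k0) - (u - u0))" using y by simp
        \<comment> \<open>This bound, and \<open>u0 \<le> k0\<close> below, make the natural
          subtractions in the arguments of \<open>Omega\<close> exact. Where one of them fails,
          \<open>cl k0 u0\<close> is empty and the binomial product is zero.\<close>
        moreover have "u - u0 \<le> k - k0"
          using card_mono[of "S \<inter> I1" "T \<inter> I1"] y finST by auto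
        ultimately show ?thesis using that by simp
      qed
      moreover have "card {h \<in> S. (h \<in> T) \<noteq> c h} = k0 + u - 2 * u0"
      proof -
        have "{h \<in> S. (h \<in> T) \<noteq> c h} = (T \<inter> I1) \<union> (S \<inter> I0 - T \<inter> I0)"
          using y by (auto simp: I0_def I1_def)
        also have "card \<dots> = card (T \<inter> I1) + card (S \<inter> I0 - T \<inter> I0)"
          using finST fin by (intro card_Un_disjoint) auto
        also have "card (S \<inter> I0 - T \<inter> I0) = k0 - u0"
          using y finST by (subst card_Diff_subset) auto
        finally have "card {h \<in> S. (h \<in> T) \<noteq> c h} = (u - u0) + (k0 - u0)" using y by simp
        moreover have "u0 \<le> k0"
          using card_mono[of "S \<inter> I0" "T \<inter> I0"] y finST by auto
        ultimately show ?thesis using that by simp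
      qed
      ultimately show "real (card {w \<in> ?D. (K w, U w) = y}) =
          Omega CARD('a) (2 * u0 + k - k0 - u) (k0 + u - 2 * u0)" by simp
    qed
    also have "\<dots> = real (card (cl k0 u0)) * Omega CARD('a) (2 * u0 + k - k0 - u) (k0 + u - 2 * u0)"
      by simp
    also have "card (cl k0 u0) =
        (card I0 choose k0) * (k0 choose u0) * ((card I1 choose (k - k0)) * ((k - k0) choose (u - u0)))"
      unfolding cl_def by (rule card_nested_subsets_Un[OF fin(1-3)])
    finally show ?thesis by (simp add: mult_ac)
  qed
  have "(\<lambda>w. (card (K w \<inter> I0), card (U w \<inter> I0))) ` ?A \<subseteq> {0..k} \<times> {0..u}"
    using split[OF KI(1)] split[OF order.trans[OF KI(2) KI(1)]] by auto
  then have "card ?A = (\<Sum>y\<in>{0..k} \<times> {0..u}. card {w \<in> ?A. (card (K w \<inter> I0), card (U w \<inter> I0)) = y})"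
    using finZ by (intro card_eq_sum_fibres) auto
  also have "real \<dots> = (\<Sum>k0=0..k. \<Sum>u0=0..u. real (card {w \<in> ?A. (card (K w \<inter> I0), card (U w \<inter> I0)) = (k0, u0)}))"
    unfolding of_nat_sum sum.cartesian_product by (intro sum.cong) auto
  also have "\<dots> = (\<Sum>k0=0..k. \<Sum>u0=0..u.
      real (card I0 choose k0) * real (card I1 choose (k - k0)) *
       real (k0 choose u0) * real ((k - k0) choose (u - u0)) *
       Omega CARD('a) (2 * u0 + k - k0 - u) (k0 + u - 2 * u0))"
    by (intro sum.cong refl block) auto
  finally show ?thesis
    by (simp only: Z_def K_def U_def I0_def I1_def mem_Collect_eq conj_assoc)
qed

end

section \<open>The relative trace\<close>

locale finite_field_extension =
  fixes \<iota> :: "'k::{field,finite} \<Rightarrow> 'a::{field,finite}" and p s m :: nat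
  assumes prime_p: "prime p" and card_base: "CARD('k) = p ^ s"
    and card_ext: "CARD('a) = CARD('k) ^ m" and hom: "field_hom \<iota>"
begin

interpretation field_hom \<iota> by (rule hom)

abbreviation tr :: "'a \<Rightarrow> 'k" where
  "tr \<equiv> rel_trace \<iota> m"

lemma card_ext_p: "CARD('a) = p ^ (s * m)"
  by (simp add: card_ext card_base power_mult)

lemma CHAR_ext: "CHAR('a) = p"
  using CHAR_eq_prime[OF prime_p card_ext_p] .

lemma card_base_ge_2: "CARD('k) \<ge> 2"
proof -
  have "card {0, 1 :: 'k} \<le> CARD('k)" by (rule card_mono) auto
  then show ?thesis by simp
qed

lemma range_embedding: "range \<iota> = {x. x ^ CARD('k) = x}"
proof (rule power_fixpoints_eq[symmetric])
  have "inj \<iota>" by (rule injI) simp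
  then show "card (range \<iota>) = CARD('k)" by (rule card_image)
  fix x assume "x \<in> range \<iota>"
  then show "x ^ CARD('k) = x"
    by (auto simp: finite_field_power_card simp flip: hom_power)
qed (rule card_base_ge_2)

lemma sum_power_card_base:
  fixes f :: "'b \<Rightarrow> 'a"
  shows "(\<Sum>j\<in>J. f j) ^ (CARD('k) ^ i) = (\<Sum>j\<in>J. f j ^ (CARD('k) ^ i))"
  using sum_power_CHAR_power[of f J "s * i"] prime_p by (simp add: CHAR_ext card_base power_mult)

text \<open>The definite description in \<open>rel_trace\<close> is justified as for
  \<open>abs_trace\<close>: the q-th power map rotates the conjugates, so their sum lies in the
  image of \<open>\<iota>\<close>, and \<open>\<iota>\<close> is injective.\<close>

lemma embedding_rel_trace: "\<iota> (tr x) = (\<Sum>i<m. x ^ (CARD('k) ^ i))"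
proof -
  have "(\<Sum>i<m. x ^ (CARD('k) ^ i)) ^ CARD('k) = (\<Sum>i<m. x ^ (CARD('k) ^ Suc i))"
    using sum_power_card_base[of "\<lambda>i. x ^ (CARD('k) ^ i)" "{..<m}" 1]
    by (simp flip: power_mult add: mult.commute)
  also have "\<dots> = (\<Sum>i<m. x ^ (CARD('k) ^ i))"
  proof (cases m)
    case (Suc l)
    have "x ^ (CARD('k) ^ Suc l) = x" using finite_field_power_card[of x] card_ext Suc by simp
    moreover have "(\<Sum>i<Suc l. x ^ (CARD('k) ^ i)) = x + (\<Sum>i<l. x ^ (CARD('k) ^ Suc i))"
      by (subst sum.lessThan_Suc_shift) simp
    ultimately show ?thesis unfolding Suc by simp
  qed simp
  finally have "(\<Sum>i<m. x ^ (CARD('k) ^ i)) \<in> range \<iota>"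
    unfolding range_embedding by (rule CollectI)
  then obtain c where c: "\<iota> c = (\<Sum>i<m. x ^ (CARD('k) ^ i))" by (metis imageE)
  show ?thesis unfolding rel_trace_def
  proof (rule theI[of _ c])
    show "\<iota> c = (\<Sum>i<m. x ^ (CARD('k) ^ i))" by (rule c)
    fix d assume "\<iota> d = (\<Sum>i<m. x ^ (CARD('k) ^ i))"
    then have "\<iota> d = \<iota> c" by (simp only: c)
    then show "d = c" by simp
  qed
qed

lemma rel_trace_add: "tr (x + y) = tr x + tr y"
proof -
  have "(x + y) ^ (CARD('k) ^ i) = x ^ (CARD('k) ^ i) + y ^ (CARD('k) ^ i)" for i
    using add_power_CHAR_power[of x y "s * i"] prime_p by (simp add: CHAR_ext card_base power_mult)
  then have "\<iota> (tr (x + y)) = \<iota> (tr x + tr y)"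
    by (simp add: embedding_rel_trace sum.distrib hom_add)
  then show ?thesis by simp
qed

lemma rel_trace_scale: "tr (\<iota> c * x) = c * tr x"
proof -
  have "\<iota> c ^ (CARD('k) ^ i) = \<iota> c" for i
  proof (induction i)
    case (Suc i)
    have "\<iota> c ^ (CARD('k) ^ Suc i) = (\<iota> c ^ (CARD('k) ^ i)) ^ CARD('k)"
      by (simp flip: power_mult add: mult.commute)
    also have "\<dots> = \<iota> c" using Suc range_embedding by auto
    finally show ?case .
  qed simp
  then have "\<iota> (tr (\<iota> c * x)) = \<iota> (c * tr x)"
    by (simp add: embedding_rel_trace power_mult_distrib sum_distrib_left hom_mult)
  then show ?thesis by simp
qed

lemma rel_trace_0 [simp]: "tr 0 = 0"
  using rel_trace_scale[of 0 0] by simp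

text \<open>Transitivity of the trace: the conjugates over the prime field are grouped by powers of \<open>q\<close>.\<close>

lemma abs_conj_sum: "(\<Sum>i<s * m. x ^ (p ^ i)) = (\<Sum>j<s. \<iota> (tr x ^ (p ^ j)))"
proof -
  have "(\<Sum>i<s * m. x ^ (p ^ i)) = (\<Sum>l<m. \<Sum>j<s. x ^ (p ^ (l * s + j)))"
    by (simp only: mult.commute[of s m] sum_lessThan_mult)
  also have "\<dots> = (\<Sum>j<s. \<Sum>l<m. (x ^ (CARD('k) ^ l)) ^ (p ^ j))"
    by (subst sum.swap) (simp add: card_base power_add mult.commute flip: power_mult)
  also have "\<dots> = (\<Sum>j<s. (\<Sum>i<m. x ^ (CARD('k) ^ i)) ^ (p ^ j))"
    using sum_power_CHAR_power[of _ "{..<m}", where 'a = 'a] prime_p by (simp add: CHAR_ext)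
  finally show ?thesis by (simp add: hom_power embedding_rel_trace)
qed

abbreviation \<psi> :: "'a \<Rightarrow> complex" where
  "\<psi> \<equiv> add_char p (s * m)"

lemma add_char_hom: "\<psi> (x + y) = \<psi> x * \<psi> y"
  by (rule add_char_add[OF prime_p card_ext_p])

text \<open>As a function of \<open>c\<close> the summand is an additive character of the small
  field. By transitivity of the trace it is trivial exactly when \<open>tr x = 0\<close>; otherwise
  scaling by \<open>1 / tr x\<close> reaches an element of nonzero absolute trace.\<close>

lemma sum_add_char_line:
  "(\<Sum>c\<in>UNIV. \<psi> (\<iota> c * x)) = (if tr x = 0 then of_nat CARD('k) else 0)"
proof -
  have eq1: "\<psi> (\<iota> c * x) = 1 \<longleftrightarrow> (\<Sum>j<s. (c * tr x) ^ (p ^ j)) = 0" for c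
  proof -
    have "(\<Sum>i<s * m. (\<iota> c * x) ^ (p ^ i)) = \<iota> (\<Sum>j<s. (c * tr x) ^ (p ^ j))"
      by (simp only: abs_conj_sum rel_trace_scale hom_sum)
    then show ?thesis by (simp only: add_char_eq_1_iff[OF prime_p card_ext_p] hom_0_iff)
  qed
  show ?thesis
  proof (cases "tr x = 0")
    case True
    have "p > 0" using prime_p prime_gt_0_nat by blast
    then have "\<psi> (\<iota> c * x) = 1" for c using eq1[of c] True by (simp add: power_0_left)
    then show ?thesis using True by simp
  next
    case False
    obtain d :: 'k where d: "(\<Sum>j<s. d ^ (p ^ j)) \<noteq> 0"
      using additive_power_sum_not_all_zero[OF prime_p card_base] by blast
    have "\<psi> (\<iota> (d / tr x) * x) \<noteq> 1" using eq1[of "d / tr x"] d False by simp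
    then have "(\<Sum>c\<in>UNIV. \<psi> (\<iota> c * x)) = 0"
      by (intro sum_add_hom_eq_0[where c = "d / tr x"]) (simp_all add: distrib_right hom_add add_char_hom)
    then show ?thesis using False by simp
  qed
qed

end

section \<open>Trace-zero elements in cosets of powers\<close>

text \<open>\<open>M\<close> is the index (r-1)/(q-1) of the multiplicative group of the small field
  in that of the large one.\<close>

locale even_index_extension = finite_field_extension \<iota> p s m + cyclic_field \<gamma>
  for \<iota> :: "'k::{field,finite} \<Rightarrow> 'a::{field,finite}" and p s m :: nat and \<gamma> :: 'a +
  fixes M :: nat
  assumes card_index: "CARD('a) - 1 = (CARD('k) - 1) * M" and even_index: "even M"
begin

interpretation field_hom \<iota> by (rule hom)

lemma odd_card_ext: "odd CARD('a)"
proof -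
  have "even (CARD('a) - 1)" using even_index by (simp only: card_index even_mult_iff simp_thms)
  then show ?thesis using CARD_ge_2 by simp
qed

sublocale quadratic_periods \<gamma> \<psi>
proof unfold_locales
  show "odd CARD('a)" by (rule odd_card_ext)
  have "p > 0" using prime_p prime_gt_0_nat by blast
  then show "\<psi> 0 = 1" by (simp add: add_char_eq_1_iff[OF prime_p card_ext_p] power_0_left)
  show "\<psi> (x + y) = \<psi> x * \<psi> y" for x y by (rule add_char_hom)
  show "\<exists>c. \<psi> c \<noteq> 1"
    using additive_power_sum_not_all_zero[OF prime_p card_ext_p] add_char_eq_1_iff[OF prime_p card_ext_p]
    by blast
qed

lemma index_pos: "M > 0"
proof (rule ccontr)
  assume "\<not> M > 0"
  then have "CARD('a) - 1 = 0" by (simp only: card_index) simp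
  then show False using CARD_ge_2 by linarith
qed

text \<open>A nonzero element of the small field is killed by the exponent q-1, so its discrete
  logarithm is a multiple of \<open>M\<close>, hence even. Scaling by the small field thus preserves
  square classes.\<close>

lemma is_square_embedding:
  assumes "c \<noteq> 0"
  shows "is_square (\<iota> c)"
proof -
  have "\<iota> c \<noteq> 0" using assms by simp
  then obtain k where k: "\<iota> c = \<gamma> powi k" by (rule nonzero_powi)
  have "\<gamma> powi (k * int (CARD('k) - 1)) = \<iota> c ^ (CARD('k) - 1)"
    by (simp only: k power_int_mult power_int_of_nat)
  also have "\<dots> = \<gamma> powi 0"
    using power_CARD_diff_1[OF assms] by (simp flip: hom_power)
  finally have "int (CARD('a) - 1) dvd k * int (CARD('k) - 1)"
    by (simp only: powi_eq_iff cong_0_iff)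
  then have "int (CARD('k) - 1) * int M dvd int (CARD('k) - 1) * k"
    by (simp only: card_index of_nat_mult mult.commute)
  then have "int M dvd k" using card_base_ge_2 by simp
  moreover have "2 dvd int M" using even_index by simp
  ultimately have "even k" using dvd_trans by blast
  then show ?thesis by (simp add: k is_square_powi_iff)
qed

lemma is_square_minus_1: "is_square (- 1 :: 'a)"
  using is_square_embedding[of "- 1"] by (simp add: hom_uminus)

text \<open>Such a power is a root of X^(q-1) - 1, hence fixed by the q-th power map.\<close>

lemma powi_index_in_range: "\<exists>c. \<gamma> powi (int M * l) = \<iota> c \<and> c \<noteq> 0"
proof -
  have "(\<gamma> powi (int M * l)) ^ (CARD('k) - 1) = \<gamma> powi (int (CARD('a) - 1) * l)"
    unfolding power_int_of_nat[of _ "CARD('k) - 1", symmetric] card_index power_int_mult[symmetric]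
    by (simp only: of_nat_mult mult_ac)
  also have "\<dots> = \<gamma> powi 0" by (simp only: powi_eq_iff cong_0_iff dvd_triv_left)
  finally have *: "(\<gamma> powi (int M * l)) ^ (CARD('k) - 1) = 1" by simp
  have "(\<gamma> powi (int M * l)) ^ CARD('k) = \<gamma> powi (int M * l) * (\<gamma> powi (int M * l)) ^ (CARD('k) - 1)"
    by (metis Suc_diff_1 finite_UNIV_card_ge_0 finite_class.finite_UNIV power_Suc)
  then have "\<gamma> powi (int M * l) \<in> range \<iota>" using * range_embedding by simp
  then show ?thesis using gen_nonzero by auto
qed

text \<open>The condition on the trace is detected by summing over the line through
  \<open>z * w\<close>. The scalar 0 contributes the number of squares; each of the other q-1
  scalars is a square and contributes the same period.\<close>

lemma card_trace_zero_squares: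
  assumes "z \<noteq> 0"
  shows "of_nat CARD('k) * of_nat (card {w \<in> sq_class True. tr (z * w) = 0}) =
    of_nat ((CARD('a) - 1) div 2) + (of_nat CARD('k) - 1) * eta (is_square z)"
proof -
  have "of_nat CARD('k) * of_nat (card {w \<in> sq_class True. tr (z * w) = 0}) =
      (\<Sum>w\<in>sq_class True. if tr (z * w) = 0 then of_nat CARD('k) else (0::complex))"
    by (simp add: sum.If_cases Int_def mult.commute)
  also have "\<dots> = (\<Sum>c\<in>UNIV. \<Sum>w\<in>sq_class True. \<psi> (\<iota> c * z * w))"
    by (subst sum.swap) (simp add: sum_add_char_line mult.assoc)
  also have "\<dots> = (\<Sum>c\<in>(UNIV :: 'k set). if c = 0 then of_nat ((CARD('a) - 1) div 2) else eta (is_square z))"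
    unfolding sum_sq_class_char
    by (intro sum.cong refl) (use assms is_square_embedding in \<open>auto simp: is_square_mult_iff\<close>)
  also have "\<dots> = of_nat ((CARD('a) - 1) div 2) + of_nat (CARD('k) - 1) * eta (is_square z)"
    by (simp add: sum.If_cases Compl_eq_Diff_UNIV card_Diff_subset)
  finally show ?thesis using card_base_ge_2 by (simp add: of_nat_diff)
qed

text \<open>The indicator \<open>F\<close> at exponent \<open>2 * i\<close> has period P = M/2,
  because \<open>\<gamma>\<close> to the power \<open>M\<close> is a scalar. Writing a e = 2 b, the
  gcd condition says that \<open>b\<close> is a unit modulo \<open>P\<close>, so the progression
  meets the periods of \<open>F\<close> as evenly as the list of all squares does. The factor 2
  arises because r-1 is twice the number of squares.\<close>

lemma card_trace_nonzero_progression: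
  fixes a :: int
  assumes "e dvd CARD('a) - 1" "gcd (int M) (a * int e) = 2"
  shows "e * card {l. l < (CARD('a) - 1) div e \<and> tr (z * \<gamma> powi (a * int e * int l)) \<noteq> 0} =
    2 * card {w \<in> sq_class True. tr (z * w) \<noteq> 0}"
proof -
  define F :: "int \<Rightarrow> nat" where "F i = of_bool (tr (z * \<gamma> powi (2 * i)) \<noteq> 0)" for i
  obtain P where P: "M = 2 * P" using even_index by (elim evenE)
  have "even (a * int e)" using gcd_dvd2[of "int M" "a * int e"] by (simp only: assms(2))
  then obtain b where b: "a * int e = 2 * b" by (elim evenE)
  obtain L where L: "CARD('a) - 1 = e * L" using assms(1) by (elim dvdE)
  have e0: "e > 0" using L CARD_ge_2 by (cases "e = 0") auto
  have L_def: "L = (CARD('a) - 1) div e" using L e0 by simp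
  have "P > 0" using P index_pos by simp
  have cop: "coprime b (int P)"
  proof -
    have "2 * gcd (int P) b = 2 * 1"
      using assms(2) unfolding P b by (simp add: gcd_mult_left)
    then show ?thesis by (simp add: coprime_iff_gcd_eq_1 gcd.commute)
  qed
  have per: "F i = F j" if "[i = j] (mod int P)" for i j
  proof -
    have "int P dvd i - j" using that by (simp only: cong_iff_dvd_diff)
    then obtain l where "i - j = int P * l" by (elim dvdE)
    then have l: "2 * i = int M * l + 2 * j" by (simp add: P algebra_simps)
    obtain c where c: "\<gamma> powi (int M * l) = \<iota> c" "c \<noteq> 0" using powi_index_in_range by blast
    have eq: "\<gamma> powi (2 * i) = \<gamma> powi (int M * l) * \<gamma> powi (2 * j)"
      using gen_nonzero by (simp only: l power_int_add simp_thms)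
    have "z * \<gamma> powi (2 * i) = \<iota> c * (z * \<gamma> powi (2 * j))" unfolding eq c(1) by (simp only: mult_ac)
    then have "tr (z * \<gamma> powi (2 * i)) = c * tr (z * \<gamma> powi (2 * j))" by (simp only: rel_trace_scale)
    then show ?thesis using c(2) by (simp add: F_def)
  qed
  have Rhalf: "(CARD('a) - 1) div 2 = (CARD('k) - 1) * P" by (simp only: card_index P)
  have dvdP: "int P dvd b * int L"
  proof -
    have "2 * (b * int L) = a * int (CARD('a) - 1)" by (simp only: L of_nat_mult mult.assoc[symmetric] b[symmetric])
    also have "\<dots> = 2 * (int P * (a * int (CARD('k) - 1)))" by (simp only: card_index P) (simp add: mult_ac)
    finally show ?thesis by simp
  qed
  have "CARD('a) - 1 = (2 * (CARD('k) - 1)) * P" by (simp only: card_index P)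
  from sum_arithmetic_progression[where F = F, OF per cop \<open>P > 0\<close> L this dvdP]
  have "e * (\<Sum>i<L. F (b * int i)) = 2 * ((CARD('k) - 1) * (\<Sum>i<P. F (int i)))" by simp
  also have "(CARD('k) - 1) * (\<Sum>i<P. F (int i)) = (\<Sum>i<(CARD('a) - 1) div 2. F (int i))"
    unfolding Rhalf using sum_periodic_mult[where F = F and P = P and L = "CARD('k) - 1", OF per] by simp
  also have "\<dots> = (\<Sum>w\<in>sq_class True. of_bool (tr (z * w) \<noteq> 0))"
    by (simp add: sum_sq_class_True F_def)
  also have "\<dots> = card {w \<in> sq_class True. tr (z * w) \<noteq> 0}"
    by (simp add: of_bool_def sum.If_cases Int_def)
  also have "(\<Sum>i<L. F (b * int i)) = card {l. l < L \<and> tr (z * \<gamma> powi (a * int e * int l)) \<noteq> 0}"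
    by (simp add: F_def of_bool_def sum.If_cases Int_def b mult.assoc)
  finally show ?thesis by (simp add: L_def)
qed

lemma card_trace_nonzero_progression_eta:
  fixes a :: int
  assumes "e dvd CARD('a) - 1" "gcd (int M) (a * int e) = 2" "z \<noteq> 0"
  shows "of_nat (e * CARD('k) * card {l. l < (CARD('a) - 1) div e \<and> tr (z * \<gamma> powi (a * int e * int l)) \<noteq> 0}) =
    (of_nat CARD('k) - 1) * (of_nat CARD('a) - 1 - 2 * eta (is_square z))"
proof -
  let ?Z = "card {w \<in> sq_class True. tr (z * w) = 0}" and ?N = "card {w \<in> sq_class True. tr (z * w) \<noteq> 0}"
  have "card ({w \<in> sq_class True. tr (z * w) = 0} \<union> {w \<in> sq_class True. tr (z * w) \<noteq> 0}) = ?Z + ?N"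
    by (intro card_Un_disjoint) auto
  moreover have "{w \<in> sq_class True. tr (z * w) = 0} \<union> {w \<in> sq_class True. tr (z * w) \<noteq> 0} = sq_class True"
    by auto
  ultimately have "card (sq_class True) = ?Z + ?N" by simp
  then have ZN: "(CARD('a) - 1) div 2 = ?Z + ?N" by (simp add: card_sq_class)
  have "CARD('a) - 1 = 2 * ((CARD('a) - 1) div 2)" using odd_card by simp
  then have "CARD('a) - 1 = 2 * (?Z + ?N)" by (simp only: ZN)
  then have "CARD('a) = 2 * (?Z + ?N) + 1" using CARD_ge_2 by linarith
  then have R: "(of_nat CARD('a) - 1 :: complex) = 2 * (of_nat ?Z + of_nat ?N)"
    by (metis (no_types, lifting) add_diff_cancel_right' of_nat_1 of_nat_add of_nat_mult of_nat_numeral)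
  \<comment> \<open>Here \<open>x\<close> stands for q, \<open>u\<close> and \<open>v\<close> for
    the numbers of squares with zero and nonzero trace, and \<open>y\<close> for the period.\<close>
  have eliminate: "x * (2 * v) = (x - 1) * (2 * (u + v) - 2 * y)" if "x * u = (u + v) + (x - 1) * y"
    for x u v y :: complex
  proof -
    have "(x - 1) * (2 * (u + v) - 2 * y) = 2 * (x * u) + 2 * (x * v) - 2 * ((u + v) + (x - 1) * y)"
      by (simp add: algebra_simps)
    then show ?thesis by (simp add: that)
  qed
  have "of_nat CARD('k) * of_nat ?Z = (of_nat ?Z + of_nat ?N) + (of_nat CARD('k) - 1) * eta (is_square z)"
    using card_trace_zero_squares[OF assms(3)] by (simp only: ZN of_nat_add)
  then have "of_nat CARD('k) * (2 * of_nat ?N) = (of_nat CARD('k) - 1) * (2 * (of_nat ?Z + of_nat ?N) - 2 * eta (is_square z))"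
    by (rule eliminate)
  moreover have "of_nat (e * card {l. l < (CARD('a) - 1) div e \<and> tr (z * \<gamma> powi (a * int e * int l)) \<noteq> 0})
      = (of_nat (2 * ?N) :: complex)"
    by (simp only: card_trace_nonzero_progression[OF assms(1,2)])
  ultimately have "of_nat CARD('k) * of_nat (e * card {l. l < (CARD('a) - 1) div e \<and> tr (z * \<gamma> powi (a * int e * int l)) \<noteq> 0})
      = (of_nat CARD('k) - 1) * (of_nat CARD('a) - 1 - 2 * eta (is_square z))"
    by (simp only: R of_nat_mult of_nat_numeral)
  then show ?thesis by (simp only: of_nat_mult mult_ac)
qed

end

section \<open>Linear codes from counting\<close>

text \<open>Coordinates with respect to a basis are unique, so the cardinality is q to the dimension
  and the exponent can be compared.\<close>

lemma dim_subspace_from_card: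
  fixes C :: "'k::{field,finite} vec set"
  assumes sub: "VectorSpace.subspace class_ring C (module_vec TYPE('k) n)" and card: "card C = CARD('k) ^ d"
  shows "vectorspace.dim class_ring (module_vec TYPE('k) n \<lparr>carrier := C\<rparr>) = d"
proof -
  let ?K = "class_ring :: 'k ring" and ?W = "module_vec TYPE('k) n \<lparr>carrier := C\<rparr>"
  interpret V: vectorspace ?K "module_vec TYPE('k) n" by (rule vec_vs)
  interpret W: vectorspace ?K ?W by (rule V.subspace_is_vs[OF sub])
  have carW: "carrier ?W = C" by simp
  have "card {0, 1 :: 'k} \<le> CARD('k)" by (rule card_mono) auto
  then have q2: "CARD('k) \<ge> 2" by simp
  then have "finite C" using card by (intro card_ge_0_finite) simp
  moreover have "W.gen_set C"
    \<comment> \<open>The finite set \<open>C\<close> generates itself, which gives finite dimension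
      and hence a finite basis.\<close>
    using W.in_own_span[of C] W.span_is_subset2[of C] by auto
  ultimately have "W.fin_dim" unfolding W.fin_dim_def by (intro exI[of _ C]) auto
  then obtain B where B: "finite B" "W.basis B" using W.finite_basis_exists by blast
  then have BC: "B \<subseteq> carrier ?W" by (simp add: W.basis_def)
  have ex1: "\<exists>!f. f \<in> B \<rightarrow>\<^sub>E carrier ?K \<and> W.lincomb f B = v" if "v \<in> C" for v
    using W.basis_criterion[OF B(1) BC] B(2) that by auto
  have "bij_betw (\<lambda>f. W.lincomb f B) (B \<rightarrow>\<^sub>E carrier ?K) C"
    unfolding bij_betw_def
  proof
    have im: "W.lincomb f B \<in> C" if "f \<in> B \<rightarrow>\<^sub>E carrier ?K" for f
      using W.lincomb_closed[OF BC, of f] that by auto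
    show "inj_on (\<lambda>f. W.lincomb f B) (B \<rightarrow>\<^sub>E carrier ?K)"
      by (rule inj_onI) (use ex1 im in blast)
    show "(\<lambda>f. W.lincomb f B) ` (B \<rightarrow>\<^sub>E carrier ?K) = C"
      using ex1 im by blast
  qed
  then have "card (B \<rightarrow>\<^sub>E carrier ?K) = card C" by (rule bij_betw_same_card)
  then have "CARD('k) ^ card B = CARD('k) ^ d" using B(1) card by (simp add: card_PiE)
  then have "card B = d" using q2 by simp
  then show ?thesis using W.dim_basis[OF B] by simp
qed

lemma hamming_dist_eq_weight:
  fixes c d :: "'k::group_add vec"
  assumes "dim_vec c = n" "dim_vec d = n"
  shows "hamming_dist c d = hamming_weight (c - d)"
  unfolding hamming_dist_def hamming_weight_def using assms
  by (intro arg_cong[where f = card]) auto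

section \<open>Discrete Fourier transform\<close>

text \<open>\<open>\<beta>\<close> has exact order \<open>e\<close> and \<open>D\<close> represents
  every residue modulo \<open>e\<close> once, so the nodes are all the e-th roots of unity.\<close>

locale dft =
  fixes \<beta> :: "'a::field" and e :: nat and D :: "nat \<Rightarrow> int"
  assumes powi_one_iff: "\<beta> powi i = 1 \<longleftrightarrow> int e dvd i"
    and e_nonzero: "of_nat e \<noteq> (0 :: 'a)"
    and distinct: "\<And>i j. i < e \<Longrightarrow> j < e \<Longrightarrow> [D i = D j] (mod int e) \<Longrightarrow> i = j"
begin

lemma e_pos: "e > 0"
  using e_nonzero by (cases "e = 0") auto

lemma root_nonzero: "\<beta> \<noteq> 0"
proof
  assume "\<beta> = 0"
  then show False using powi_one_iff[of "int e"] e_pos by (simp add: zero_power)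
qed

lemma powi_cong:
  assumes "[i = j] (mod int e)"
  shows "\<beta> powi i = \<beta> powi j"
proof -
  have "\<beta> powi (i - j) = 1" using assms by (simp add: powi_one_iff cong_iff_dvd_diff)
  moreover have "\<beta> powi i = \<beta> powi (i - j) * \<beta> powi j"
    using root_nonzero by (simp flip: power_int_add)
  ultimately show ?thesis by simp
qed

lemma sum_powi: "(\<Sum>h<e. \<beta> powi (int h * d)) = (if int e dvd d then of_nat e else 0)"
proof (cases "int e dvd d")
  case True
  then have "\<beta> powi (int h * d) = 1" for h by (simp add: powi_one_iff)
  then show ?thesis using True by simp
next
  case False
  let ?z = "\<beta> powi d"
  have pw: "\<beta> powi (int h * d) = ?z ^ h" for h
    by (simp only: mult.commute[of _ d] power_int_mult power_int_of_nat)
  have "?z ^ e = 1" using powi_one_iff[of "int e * d"] by (simp only: pw dvd_triv_left)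
  then have "(?z - 1) * (\<Sum>h<e. ?z ^ h) = 0" by (simp flip: power_diff_1_eq)
  moreover have "?z \<noteq> 1" using False by (simp add: powi_one_iff)
  ultimately show ?thesis using False by (simp add: pw)
qed

text \<open>The dual orthogonality, summed over nodes instead of powers: the residues of
  \<open>D\<close> permute the exponents below \<open>e\<close>.\<close>

lemma sum_powi_nodes:
  assumes "h < e" "h' < e"
  shows "(\<Sum>j<e. \<beta> powi ((int h - int h') * D j)) = (if h = h' then of_nat e else 0)"
proof -
  let ?n = "\<lambda>j. nat (D j mod int e)"
  have pos: "int e > 0" using e_pos by simp
  have sub: "?n ` {..<e} \<subseteq> {..<e}" using pos by (auto simp: nat_less_iff)
  have inj: "inj_on ?n {..<e}"
  proof (rule inj_onI)
    fix i j assume ij: "i \<in> {..<e}" "j \<in> {..<e}" "?n i = ?n j"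
    then have "D i mod int e = D j mod int e" using pos by (simp add: eq_nat_nat_iff)
    then show "i = j" using ij by (intro distinct) (auto simp: cong_def)
  qed
  have bij: "bij_betw ?n {..<e} {..<e}"
    using endo_inj_surj[OF _ sub inj] inj by (auto simp: bij_betw_def)
  have "(\<Sum>j<e. \<beta> powi ((int h - int h') * D j)) = (\<Sum>j<e. \<beta> powi (int (?n j) * (int h - int h')))"
  proof (rule sum.cong[OF refl])
    fix j
    have "[(int h - int h') * D j = int (?n j) * (int h - int h')] (mod int e)"
      using pos by (simp add: mult.commute cong_def mod_mult_right_eq)
    then show "\<beta> powi ((int h - int h') * D j) = \<beta> powi (int (?n j) * (int h - int h'))"
      by (rule powi_cong)
  qed
  also have "\<dots> = (\<Sum>d<e. \<beta> powi (int d * (int h - int h')))"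
    by (rule sum.reindex_bij_betw[OF bij])
  also have "\<dots> = (if int e dvd int h - int h' then of_nat e else 0)" by (rule sum_powi)
  also have "int e dvd int h - int h' \<longleftrightarrow> h = h'"
  proof -
    have "int e dvd int h - int h' \<longleftrightarrow> [h = h'] (mod e)"
      by (simp only: cong_iff_dvd_diff[symmetric] cong_int_iff)
    then show ?thesis using assms by (simp add: cong_def)
  qed
  finally show ?thesis .
qed

text \<open>The coordinate \<open>y_h\<close> of the matrix product, read as a Fourier transform
  whose input at node 0 is zero.\<close>

definition transform :: "(nat \<Rightarrow> 'a) \<Rightarrow> nat \<Rightarrow> 'a" where
  "transform x h = (\<Sum>j=1..<e. x j * \<beta> powi (int h * D j))"

text \<open>The node \<open>D 0\<close> is missing from the transform, which yields the relation with these coefficients.\<close>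

definition coef :: "nat \<Rightarrow> 'a" where
  "coef h = \<beta> powi (- int h * D 0)"

lemma coef_nonzero: "coef h \<noteq> 0"
  using root_nonzero by (simp add: coef_def)

lemma coef_0: "coef 0 = 1"
  by (simp add: coef_def)

text \<open>Absorbing the coefficients makes the linear relation symmetric in all positions. The
  restriction makes the function extensional, so that it can take part in a bijection.\<close>

definition weighted :: "(nat \<Rightarrow> 'a) \<Rightarrow> nat \<Rightarrow> 'a" where
  "weighted x = (\<lambda>h\<in>{..<e}. coef h * transform x h)"

text \<open>Fourier inversion; the case \<open>i = 0\<close> is the linear relation itself, the
  other cases recover the input.\<close>

lemma sum_inverse_transform:
  assumes "i < e"
  shows "(\<Sum>h<e. \<beta> powi (- int h * D i) * transform x h) = (if i = 0 then 0 else of_nat e * x i)"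
proof -
  have "(\<Sum>h<e. \<beta> powi (- int h * D i) * transform x h) =
      (\<Sum>h<e. \<Sum>j=1..<e. x j * \<beta> powi (int h * (D j - D i)))"
    unfolding transform_def sum_distrib_left
  proof (intro sum.cong refl)
    fix h j
    have "\<beta> powi (int h * (D j - D i)) = \<beta> powi (- int h * D i + int h * D j)"
      by (simp add: algebra_simps)
    also have "\<dots> = \<beta> powi (- int h * D i) * \<beta> powi (int h * D j)"
      using root_nonzero by (simp only: power_int_add simp_thms)
    finally show "\<beta> powi (- int h * D i) * (x j * \<beta> powi (int h * D j)) = x j * \<beta> powi (int h * (D j - D i))"
      by (simp only: mult_ac)
  qed
  also have "\<dots> = (\<Sum>j=1..<e. x j * (\<Sum>h<e. \<beta> powi (int h * (D j - D i))))"
    by (subst sum.swap) (simp only: sum_distrib_left)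
  also have "\<dots> = (\<Sum>j=1..<e. if j = i then x j * of_nat e else 0)"
  proof (intro sum.cong refl)
    fix j assume j: "j \<in> {1..<e}"
    have "int e dvd D j - D i \<longleftrightarrow> j = i"
      using distinct[of j i] j assms by (auto simp: cong_iff_dvd_diff)
    then show "x j * (\<Sum>h<e. \<beta> powi (int h * (D j - D i))) = (if j = i then x j * of_nat e else 0)"
      by (simp add: sum_powi)
  qed
  also have "\<dots> = (if i = 0 then 0 else of_nat e * x i)"
    using assms by (simp add: sum.delta)
  finally show ?thesis .
qed

lemma sum_weighted: "(\<Sum>h<e. weighted x h) = 0"
  using sum_inverse_transform[of 0 x] e_pos by (simp add: weighted_def coef_def)

text \<open>The witness is the inverse Fourier transform. A function on \<open>{..<e}\<close> comes
  from an input without node 0 exactly when its inverse transform vanishes there, which is the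
  zero-sum condition.\<close>

lemma bij_betw_weighted:
  "bij_betw weighted (PiE {1..<e} (\<lambda>_. UNIV)) {w \<in> PiE {..<e} (\<lambda>_. UNIV). (\<Sum>h<e. w h) = 0}"
proof (rule bij_betw_byWitness[where
      f' = "\<lambda>w. \<lambda>i\<in>{1..<e}. (\<Sum>h<e. \<beta> powi (- int h * D i) * (w h / coef h)) / of_nat e"], goal_cases)
  case 1
  show ?case
  proof
    fix x :: "nat \<Rightarrow> 'a" assume x: "x \<in> PiE {1..<e} (\<lambda>_. UNIV)"
    show "(\<lambda>i\<in>{1..<e}. (\<Sum>h<e. \<beta> powi (- int h * D i) * (weighted x h / coef h)) / of_nat e) = x"
    proof (rule ext)
      fix i
      show "(\<lambda>i\<in>{1..<e}. (\<Sum>h<e. \<beta> powi (- int h * D i) * (weighted x h / coef h)) / of_nat e) i = x i"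
      proof (cases "i \<in> {1..<e}")
        case True
        have "(\<Sum>h<e. \<beta> powi (- int h * D i) * (weighted x h / coef h)) =
            (\<Sum>h<e. \<beta> powi (- int h * D i) * transform x h)"
          by (intro sum.cong) (auto simp: weighted_def coef_nonzero)
        also have "\<dots> = of_nat e * x i" using sum_inverse_transform[of i x] True by simp
        finally show ?thesis using True e_nonzero by simp
      qed (use x in \<open>auto simp: PiE_def extensional_def\<close>)
    qed
  qed
next
  case 2
  show ?case
  proof
    fix w :: "nat \<Rightarrow> 'a" assume w: "w \<in> {w \<in> PiE {..<e} (\<lambda>_. UNIV). (\<Sum>h<e. w h) = 0}"
    define v where "v h = w h / coef h" for h
    define s where "s i = (\<Sum>h<e. \<beta> powi (- int h * D i) * v h)" for i
    let ?x = "\<lambda>i\<in>{1..<e}. s i / of_nat e"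
    \<comment> \<open>\<open>s 0\<close> is the value at the missing node; as it vanishes, the sum
      over \<open>j\<close> can be completed by \<open>j = 0\<close> before orthogonality is
      applied.\<close>
    have "s 0 = (\<Sum>h<e. w h)"
      unfolding s_def v_def coef_def[symmetric] using coef_nonzero by (intro sum.cong) auto
    then have s0: "s 0 = 0" using w by simp
    have "weighted ?x h = w h" if h: "h < e" for h
    proof -
      have "of_nat e * transform ?x h = (\<Sum>j=1..<e. s j * \<beta> powi (int h * D j))"
        unfolding transform_def sum_distrib_left using e_nonzero by (intro sum.cong) auto
      also have "\<dots> = (\<Sum>j<e. s j * \<beta> powi (int h * D j))"
        using s0 by (intro sum.mono_neutral_left) (auto simp: not_less_eq_eq less_Suc_eq_le)
      also have "\<dots> = (\<Sum>j<e. \<Sum>h'<e. v h' * \<beta> powi ((int h - int h') * D j))"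
        unfolding s_def sum_distrib_right
      proof (intro sum.cong refl)
        fix j h'
        have "\<beta> powi ((int h - int h') * D j) = \<beta> powi (- int h' * D j + int h * D j)"
          by (simp add: algebra_simps)
        also have "\<dots> = \<beta> powi (- int h' * D j) * \<beta> powi (int h * D j)"
          using root_nonzero by (simp only: power_int_add simp_thms)
        finally show "\<beta> powi (- int h' * D j) * v h' * \<beta> powi (int h * D j) =
            v h' * \<beta> powi ((int h - int h') * D j)" by (simp only: mult_ac)
      qed
      also have "\<dots> = (\<Sum>h'<e. v h' * (\<Sum>j<e. \<beta> powi ((int h - int h') * D j)))"
        by (subst sum.swap) (simp only: sum_distrib_left)
      also have "\<dots> = (\<Sum>h'<e. if h' = h then v h' * of_nat e else 0)"
        using h by (intro sum.cong refl) (simp add: sum_powi_nodes)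
      also have "\<dots> = of_nat e * v h" using h by simp
      finally have "transform ?x h = v h" using e_nonzero by simp
      then show ?thesis using h coef_nonzero by (simp add: weighted_def v_def)
    qed
    then show "weighted (\<lambda>i\<in>{1..<e}. (\<Sum>h<e. \<beta> powi (- int h * D i) * (w h / coef h)) / of_nat e) = w"
      using w by (intro ext) (auto simp: weighted_def PiE_def extensional_def s_def v_def)
  qed
next
  case 3
  show ?case using sum_weighted by (auto simp: weighted_def split: if_splits)
next
  case 4
  show ?case by (intro image_subsetI restrict_PiE_iff[THEN iffD2] ballI UNIV_I)
qed

lemma relation_unique:
  assumes "\<And>x. transform x 0 + (\<Sum>i=1..<e. l i * transform x i) = 0" "i \<in> {1..<e}"
  shows "l i = coef i"
proof -
  \<comment> \<open>A test vector in the hyperplane supported on 0 and \<open>i\<close>; applied to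
    its preimage, the relation involves only \<open>l i\<close>.\<close>
  let ?w = "\<lambda>h\<in>{..<e}. if h = 0 then - 1 else if h = i then 1 else (0 :: 'a)"
  have "(\<Sum>h<e. ?w h) = (\<Sum>h\<in>{0, i}. ?w h)"
    using assms(2) by (intro sum.mono_neutral_right) auto
  also have "\<dots> = 0" using assms(2) by auto
  finally have "?w \<in> {w \<in> PiE {..<e} (\<lambda>_. UNIV). (\<Sum>h<e. w h) = 0}" by auto
  then obtain x where x: "weighted x = ?w"
    using bij_betw_weighted unfolding bij_betw_def by (metis (no_types, lifting) imageE)
  have tx: "transform x h = ?w h / coef h" if "h < e" for h
    using fun_cong[OF x, of h] that coef_nonzero[of h] by (simp add: weighted_def field_simps)
  have "(\<Sum>j=1..<e. l j * transform x j) = (\<Sum>j\<in>{i}. l j * transform x j)"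
    using assms(2) by (intro sum.mono_neutral_right) (auto simp: tx)
  then have "- 1 + l i / coef i = 0"
    using assms(1)[of x] assms(2) e_pos by (simp add: tx coef_0)
  then show ?thesis using coef_nonzero[of i] by (simp add: field_simps)
qed

lemma relation_coeffs_eq:
  assumes "e = t + 1"
  shows "relation_coeffs (B_mat \<beta> t D) t = restrict coef {1..t}"
proof -
  have set: "{1..<e} = {1..t}" using assms by auto
  \<comment> \<open>Vectors are zero-based while the inputs count from 1, whence the index
    \<open>j - 1\<close>.\<close>
  have Bx: "(B_mat \<beta> t D *\<^sub>v x) $ h = transform (\<lambda>j. x $ (j - 1)) h" if "x \<in> carrier_vec t" "h < e" for x h
  proof -
    have "(B_mat \<beta> t D *\<^sub>v x) $ h = (\<Sum>i<t. \<beta> powi (int h * D (i + 1)) * x $ i)"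
      using that assms by (simp add: B_mat_def scalar_prod_def atLeast0LessThan)
    also have "\<dots> = (\<Sum>j=1..t. \<beta> powi (int h * D j) * x $ (j - 1))"
      by (rule sum.reindex_bij_witness[of _ "\<lambda>j. j - 1" "\<lambda>i. i + 1"]) auto
    finally show ?thesis by (simp only: transform_def set mult.commute)
  qed
  have "(\<Sum>h<e. coef h * transform x h) = 0" for x
    using sum_weighted[of x] by (simp add: weighted_def)
  moreover have "(\<Sum>h<e. coef h * transform x h) = transform x 0 + (\<Sum>i=1..t. coef i * transform x i)" for x
    using e_pos coef_0 sum.atLeast_Suc_lessThan[of 0 e "\<lambda>h. coef h * transform x h"]
    by (simp add: atLeast0LessThan set[unfolded One_nat_def])
  ultimately have rel: "transform x 0 + (\<Sum>i=1..t. coef i * transform x i) = 0" for x by metis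
  show ?thesis unfolding relation_coeffs_def
  proof (rule the_equality)
    show "restrict coef {1..t} \<in> extensional {1..t} \<and>
      (\<forall>x\<in>carrier_vec t. (B_mat \<beta> t D *\<^sub>v x) $ 0 +
        (\<Sum>i=1..t. restrict coef {1..t} i * (B_mat \<beta> t D *\<^sub>v x) $ i) = 0)"
      using rel assms by (auto simp: Bx)
  next
    fix l assume l: "l \<in> extensional {1..t} \<and>
      (\<forall>x\<in>carrier_vec t. (B_mat \<beta> t D *\<^sub>v x) $ 0 + (\<Sum>i=1..t. l i * (B_mat \<beta> t D *\<^sub>v x) $ i) = 0)"
    have "transform y 0 + (\<Sum>i=1..<e. l i * transform y i) = 0" for y
    proof -
      let ?x = "vec t (\<lambda>i. y (i + 1))"
      have "transform (\<lambda>j. ?x $ (j - 1)) h = transform y h" for h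
        unfolding transform_def set by (intro sum.cong) auto
      then show ?thesis using l assms unfolding set by (auto simp: Bx dest!: bspec[of _ _ ?x])
    qed
    then have eq: "l i = coef i" if "i \<in> {1..t}" for i
      using relation_unique that unfolding set by blast
    have ext: "l \<in> extensional {1..t}" using l by (rule conjunct1)
    show "l = restrict coef {1..t}"
      by (rule extensionalityI[OF ext restrict_extensional]) (simp only: eq restrict_apply if_True)
  qed
qed

end

section \<open>Weights of the trace code\<close>

lemma sum_if_two_values:
  fixes f :: "bool \<Rightarrow> complex"
  assumes "finite I" "K \<subseteq> I" "U \<subseteq> K"
  shows "(\<Sum>h\<in>I. if h \<in> K then f (h \<in> U) else 0) =
    of_nat (card U) * f True + (of_nat (card K) - of_nat (card U)) * f False"
proof -
  have fin: "finite K" "finite U" using assms by (auto intro: finite_subset)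
  have "(\<Sum>h\<in>I. if h \<in> K then f (h \<in> U) else 0) = (\<Sum>h\<in>K. f (h \<in> U))"
    using assms by (simp add: sum.If_cases Int_absorb1)
  also have "\<dots> = (\<Sum>h\<in>K - U. f (h \<in> U)) + (\<Sum>h\<in>U. f (h \<in> U))"
    by (rule sum.subset_diff[OF assms(3) fin(1)])
  also have "(\<Sum>h\<in>U. f (h \<in> U)) = of_nat (card U) * f True" by simp
  also have "(\<Sum>h\<in>K - U. f (h \<in> U)) = of_nat (card (K - U)) * f False" by simp
  also have "of_nat (card (K - U)) = (of_nat (card K) - of_nat (card U) :: complex)"
    using assms fin by (simp add: card_Diff_subset card_mono of_nat_diff)
  finally show ?thesis by simp
qed

text \<open>
  As \<open>t = e - 1\<close>, the exponents \<open>\<Delta>\<^sub>1, \<dots>, \<Delta>\<^sub>t\<close> miss exactly one residue class modulo \<open>e\<close>;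
  \<open>D\<close> extends them by a representative \<open>D 0\<close> of that class.
\<close>

locale trace_code_setting = even_index_extension \<iota> p s m \<gamma> M
  for \<iota> :: "'k::{field,finite} \<Rightarrow> 'a::{field,finite}" and p s m :: nat and \<gamma> :: 'a and M :: nat +
  fixes e t n \<delta> :: nat and a :: int and D as :: "nat \<Rightarrow> int"
  assumes t_ge_2: "t \<ge> 2" and e_eq: "e = t + 1" and e_dvd: "e dvd CARD('a) - 1"
    and gcd_index: "gcd (int M) (a * int e) = 2"
    and nodes_distinct: "\<And>i j. i < e \<Longrightarrow> j < e \<Longrightarrow> [D i = D j] (mod int e) \<Longrightarrow> i = j"
    and as_cong: "\<And>i. i \<in> {1..t} \<Longrightarrow> [as i = a + int ((CARD('a) - 1) div e) * D i] (mod int (CARD('a) - 1))"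
    and delta_n: "CARD('a) - 1 = \<delta> * n" and delta_dvd: "\<And>i. i \<in> {1..t} \<Longrightarrow> int \<delta> dvd as i"
begin

interpretation field_hom \<iota> by (rule hom)

definition \<beta> :: 'a where "\<beta> = \<gamma> ^ ((CARD('a) - 1) div e)"

abbreviation g :: 'a where "g \<equiv> \<gamma> powi a"

lemma card_L: "CARD('a) - 1 = e * ((CARD('a) - 1) div e)"
  using e_dvd by simp

lemma root_powi: "\<beta> powi i = \<gamma> powi (int ((CARD('a) - 1) div e) * i)"
  by (simp only: \<beta>_def power_int_mult power_int_of_nat)

lemma L_pos: "(CARD('a) - 1) div e > 0"
proof (rule ccontr)
  assume "\<not> (CARD('a) - 1) div e > 0"
  then have "(CARD('a) - 1) div e = 0" by simp
  then have "CARD('a) - 1 = 0" using card_L by (simp only: mult_0_right)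
  then show False using CARD_ge_2 by linarith
qed

sublocale dft \<beta> e D
proof
  fix i
  have "\<beta> powi i = 1 \<longleftrightarrow> \<gamma> powi (int ((CARD('a) - 1) div e) * i) = \<gamma> powi 0"
    by (simp only: root_powi power_int_0_right)
  also have "\<dots> \<longleftrightarrow> int (e * ((CARD('a) - 1) div e)) dvd int ((CARD('a) - 1) div e) * i"
    by (simp only: powi_eq_iff cong_0_iff card_L[symmetric])
  also have "\<dots> \<longleftrightarrow> int ((CARD('a) - 1) div e) * int e dvd int ((CARD('a) - 1) div e) * i"
    by (simp only: of_nat_mult mult.commute)
  also have "\<dots> \<longleftrightarrow> int e dvd i"
    using L_pos by (simp only: dvd_mult_cancel_left of_nat_eq_0_iff) simp
  finally show "\<beta> powi i = 1 \<longleftrightarrow> int e dvd i" .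
next
  show "of_nat e \<noteq> (0 :: 'a)"
  \<comment> \<open>\<open>e\<close> divides r-1, and r-1 equals -1 in the field.\<close>
  proof
    assume "of_nat e = (0 :: 'a)"
    then have "of_nat (e * ((CARD('a) - 1) div e)) = (0 :: 'a)" by (simp only: of_nat_mult mult_zero_left)
    then have "of_nat (CARD('a) - 1) = (0 :: 'a)" by (simp only: card_L[symmetric])
    moreover have "of_nat CARD('a) = (of_nat (CARD('a) - 1) + 1 :: 'a)"
      using CARD_ge_2 by (simp add: of_nat_diff)
    ultimately have "(0 :: 'a) = 0 + 1" by (simp only: of_nat_CARD_eq_0)
    then show False by simp
  qed
qed (rule nodes_distinct)

text \<open>Defined at every integer position, so that the shift to \<open>i - 1\<close> and
  reduction modulo \<open>n\<close> need no case distinction.\<close>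

definition evaluation :: "(nat \<Rightarrow> 'a) \<Rightarrow> int \<Rightarrow> 'a" where
  "evaluation x i = (\<Sum>j=1..t. x j * \<gamma> powi (as j * i))"

definition codeword :: "(nat \<Rightarrow> 'a) \<Rightarrow> 'k vec" where
  "codeword x = vec n (\<lambda>i. tr (evaluation x (int i)))"

lemma trace_code_eq: "trace_code \<iota> m \<gamma> n t as = range codeword"
  unfolding trace_code_def codeword_def evaluation_def full_SetCompr_eq[symmetric] by simp

lemma n_pos: "n > 0" and delta_pos: "\<delta> > 0"
proof -
  have "\<delta> * n > 0" using CARD_ge_2 by (simp only: delta_n[symmetric])
  then show "n > 0" "\<delta> > 0" by simp_all
qed

text \<open>Every exponent is a multiple of \<open>\<delta>\<close> and r-1 equals
  \<open>\<delta> * n\<close>. This periodicity serves both the cyclic shift and the passage to full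
  length r-1.\<close>

lemma evaluation_cong:
  assumes "[i = j] (mod int n)"
  shows "evaluation x i = evaluation x j"
  unfolding evaluation_def
proof (intro sum.cong refl)
  fix l assume l: "l \<in> {1..t}"
  have "int \<delta> * int n dvd as l * (i - j)"
    using delta_dvd[OF l] assms by (intro mult_dvd_mono) (auto simp: cong_iff_dvd_diff)
  then have "\<gamma> powi (as l * i) = \<gamma> powi (as l * j)"
    by (simp only: powi_eq_iff cong_iff_dvd_diff delta_n of_nat_mult right_diff_distrib)
  then show "x l * \<gamma> powi (as l * i) = x l * \<gamma> powi (as l * j)" by (simp only:)
qed

text \<open>At position l e + h the term (r-1)/e * D j * l e is a multiple of r-1 and drops out. The
  dependence on \<open>l\<close> is then the same for every \<open>j\<close> and factors out of the
  sum.\<close>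

lemma evaluation_split:
  "evaluation x (int (l * e + h)) = g ^ h * transform x h * \<gamma> powi (a * int e * int l)"
proof -
  have "\<gamma> powi (as j * int (l * e + h)) = g ^ h * \<beta> powi (int h * D j) * \<gamma> powi (a * int e * int l)"
    if j: "j \<in> {1..t}" for j
  proof -
    let ?L = "int ((CARD('a) - 1) div e)"
    have "[as j * int (l * e + h) = (a + ?L * D j) * int (l * e + h)] (mod int (CARD('a) - 1))"
      by (rule cong_mult[OF as_cong[OF j] cong_refl])
    also have "(a + ?L * D j) * int (l * e + h) =
        int (e * ((CARD('a) - 1) div e)) * (D j * int l) + (a * int h + ?L * (int h * D j) + a * int e * int l)"
      by (simp add: algebra_simps)
    also have "[\<dots> = a * int h + ?L * (int h * D j) + a * int e * int l] (mod int (CARD('a) - 1))"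
      unfolding card_L[symmetric] by (simp add: cong_def)
    finally have "\<gamma> powi (as j * int (l * e + h)) = \<gamma> powi (a * int h + ?L * (int h * D j) + a * int e * int l)"
      by (simp only: powi_eq_iff)
    also have "\<dots> = \<gamma> powi (a * int h) * \<gamma> powi (?L * (int h * D j)) * \<gamma> powi (a * int e * int l)"
      using gen_nonzero by (simp only: power_int_add simp_thms)
    also have "\<gamma> powi (a * int h) = g ^ h" by (simp only: power_int_mult power_int_of_nat)
    finally show ?thesis by (simp only: root_powi)
  qed
  then have "evaluation x (int (l * e + h)) =
      (\<Sum>j=1..t. x j * (g ^ h * \<beta> powi (int h * D j) * \<gamma> powi (a * int e * int l)))"
    unfolding evaluation_def by (intro sum.cong) auto
  also have "\<dots> = (\<Sum>j=1..t. g ^ h * (x j * \<beta> powi (int h * D j)) * \<gamma> powi (a * int e * int l))"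
    by (intro sum.cong) (auto simp only: mult_ac)
  also have "\<dots> = g ^ h * (\<Sum>j=1..t. x j * \<beta> powi (int h * D j)) * \<gamma> powi (a * int e * int l)"
    by (simp only: sum_distrib_left sum_distrib_right)
  also have "{1..t} = {1..<e}" using e_eq by auto
  finally show ?thesis by (simp only: transform_def)
qed

text \<open>Repeating the word \<open>\<delta>\<close> times gives length r-1, which
  \<open>e\<close> divides, so the positions can be sorted by residue modulo
  \<open>e\<close>.\<close>

lemma delta_weight:
  "\<delta> * hamming_weight (codeword x) =
    (\<Sum>h<e. card {l. l < (CARD('a) - 1) div e \<and>
       tr (g ^ h * transform x h * \<gamma> powi (a * int e * int l)) \<noteq> 0})"
proof -
  define F :: "int \<Rightarrow> nat" where "F i = of_bool (tr (evaluation x i) \<noteq> 0)" for i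
  have per: "F i = F j" if "[i = j] (mod int n)" for i j
    using evaluation_cong[OF that] by (simp add: F_def)
  have "hamming_weight (codeword x) = card {i. i < n \<and> tr (evaluation x (int i)) \<noteq> 0}"
    unfolding hamming_weight_def codeword_def by (intro arg_cong[where f = card]) auto
  also have "\<dots> = (\<Sum>i<n. F (int i))"
    by (simp add: F_def of_bool_def sum.If_cases Int_def)
  finally have "\<delta> * hamming_weight (codeword x) = (\<Sum>i<\<delta> * n. F (int i))"
    using sum_periodic_mult[where F = F and P = n and L = \<delta>, OF per] by simp
  also have "\<delta> * n = ((CARD('a) - 1) div e) * e" using delta_n card_L by (metis mult.commute)
  also have "(\<Sum>i<((CARD('a) - 1) div e) * e. F (int i)) =
      (\<Sum>h<e. \<Sum>l<(CARD('a) - 1) div e. F (int (l * e + h)))"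
    by (simp only: sum_lessThan_mult) (rule sum.swap)
  also have "\<dots> = (\<Sum>h<e. card {l. l < (CARD('a) - 1) div e \<and>
       tr (g ^ h * transform x h * \<gamma> powi (a * int e * int l)) \<noteq> 0})"
  proof (rule sum.cong[OF refl])
    fix h
    show "(\<Sum>l<(CARD('a) - 1) div e. F (int (l * e + h))) = card {l. l < (CARD('a) - 1) div e \<and>
       tr (g ^ h * transform x h * \<gamma> powi (a * int e * int l)) \<noteq> 0}"
      unfolding F_def evaluation_split by (simp add: of_bool_def sum.If_cases Int_def)
  qed
  finally show ?thesis .
qed

definition square_coef :: "nat \<Rightarrow> bool" where
  "square_coef h = is_square (coef h * g ^ h)"

definition supp :: "(nat \<Rightarrow> 'a) \<Rightarrow> nat set" where
  "supp w = {h \<in> {..<e}. w h \<noteq> 0}"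

text \<open>For \<open>w = weighted x\<close> these are the positions where
  \<open>g ^ h * transform x h\<close> is a nonzero square, expressed through \<open>w\<close> alone
  by comparing its class with that of the coefficient.\<close>

definition sq_supp :: "(nat \<Rightarrow> 'a) \<Rightarrow> nat set" where
  "sq_supp w = {h \<in> {..<e}. w h \<noteq> 0 \<and> is_square (w h) = square_coef h}"

lemma supp_finite: "finite (supp w)" and supp_le: "card (supp w) \<le> e"
  and sq_supp_subset: "sq_supp w \<subseteq> supp w"
proof -
  show fin: "finite (supp w)" by (simp add: supp_def)
  have "card (supp w) \<le> card {..<e}" by (rule card_mono) (auto simp: supp_def)
  then show "card (supp w) \<le> e" by simp
  show "sq_supp w \<subseteq> supp w" by (auto simp: supp_def sq_supp_def)
qed

lemma sq_supp_le: "card (sq_supp w) \<le> card (supp w)"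
  using supp_finite sq_supp_subset by (rule card_mono)

text \<open>The factor \<open>e\<close> comes from the progression count, q from summing over lines,
  and \<open>\<delta>\<close> from repeating the word; keeping them on the left avoids
  division.\<close>

lemma weight_formula:
  "of_nat (e * CARD('k) * (\<delta> * hamming_weight (codeword x))) =
    (of_nat CARD('k) - 1) * (of_nat (card (supp (weighted x))) * (of_nat CARD('a) - 1)
      - 2 * of_nat (card (sq_supp (weighted x))) * eta True
      - 2 * (of_nat (card (supp (weighted x))) - of_nat (card (sq_supp (weighted x)))) * eta False)"
proof -
  let ?w = "weighted x"
  let ?c = "\<lambda>h. card {l. l < (CARD('a) - 1) div e \<and>
       tr (g ^ h * transform x h * \<gamma> powi (a * int e * int l)) \<noteq> 0}"
  let ?f = "\<lambda>b. (of_nat CARD('k) - 1) * (of_nat CARD('a) - 1 - 2 * eta b) :: complex"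
  have "of_nat (e * CARD('k) * ?c h) = (if h \<in> supp ?w then ?f (h \<in> sq_supp ?w) else 0)"
    if h: "h \<in> {..<e}" for h
  proof (cases "transform x h = 0")
    case True
    then have "h \<notin> supp ?w" using h by (simp add: supp_def weighted_def)
    moreover have "?c h = 0" using True by simp
    ultimately show ?thesis by simp
  next
    case False
    have w: "?w h = coef h * transform x h" using h by (simp add: weighted_def)
    have g: "g ^ h \<noteq> 0" using gen_nonzero by simp
    have sup: "h \<in> supp ?w" using h False coef_nonzero[of h] by (simp add: supp_def w)
    have "is_square (g ^ h * transform x h) \<longleftrightarrow> h \<in> sq_supp ?w"
      using h False coef_nonzero[of h] g w
      by (auto simp: sq_supp_def square_coef_def is_square_mult_iff)
    moreover have "g ^ h * transform x h \<noteq> 0" using g False by simp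
    from card_trace_nonzero_progression_eta[OF e_dvd gcd_index this]
    have "of_nat (e * CARD('k) * ?c h) = ?f (is_square (g ^ h * transform x h))" .
    ultimately show ?thesis using sup by simp
  qed
  then have "(\<Sum>h<e. of_nat (e * CARD('k) * ?c h)) =
      (\<Sum>h<e. if h \<in> supp ?w then ?f (h \<in> sq_supp ?w) else 0)"
    by (intro sum.cong) auto
  also have "\<dots> = of_nat (card (sq_supp ?w)) * ?f True +
      (of_nat (card (supp ?w)) - of_nat (card (sq_supp ?w))) * ?f False"
    by (rule sum_if_two_values[OF _ _ sq_supp_subset]) (auto simp: supp_def)
  also have "(\<Sum>h<e. of_nat (e * CARD('k) * ?c h)) = of_nat (e * CARD('k) * (\<delta> * hamming_weight (codeword x)))"
    unfolding delta_weight by (simp only: sum_distrib_left of_nat_sum)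
  finally show ?thesis by (simp add: algebra_simps)
qed

lemma eta_real:
  obtains \<sigma> where "\<sigma> = sqrt CARD('a) \<or> \<sigma> = - sqrt CARD('a)"
    "eta True = of_real ((\<sigma> - 1) / 2)" "eta False = of_real ((- \<sigma> - 1) / 2)"
proof -
  from eta_cases[OF is_square_minus_1] show ?thesis
  proof
    assume "eta True = - (1 - of_real (sqrt CARD('a))) / 2 \<and> eta False = - (1 + of_real (sqrt CARD('a))) / 2"
    then show ?thesis by (intro that[of "sqrt CARD('a)"]) auto
  next
    assume "eta True = - (1 + of_real (sqrt CARD('a))) / 2 \<and> eta False = - (1 - of_real (sqrt CARD('a))) / 2"
    then show ?thesis by (intro that[of "- sqrt CARD('a)"]) auto
  qed
qed

lemma weight_real:
  assumes "eta True = of_real ((\<sigma> - 1) / 2)" "eta False = of_real ((- \<sigma> - 1) / 2)"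
  shows "real (e * CARD('k) * (\<delta> * hamming_weight (codeword x))) =
    (real CARD('k) - 1) * (real (card (supp (weighted x))) * real CARD('a)
      + (real (card (supp (weighted x))) - 2 * real (card (sq_supp (weighted x)))) * \<sigma>)"
proof -
  let ?k = "card (supp (weighted x))" and ?u = "card (sq_supp (weighted x))"
  have "complex_of_real (real (e * CARD('k) * (\<delta> * hamming_weight (codeword x)))) =
    complex_of_real ((real CARD('k) - 1) * (real ?k * (real CARD('a) - 1)
      - 2 * real ?u * ((\<sigma> - 1) / 2) - 2 * (real ?k - real ?u) * ((- \<sigma> - 1) / 2)))"
    using weight_formula[of x] unfolding assms by simp
  then have "real (e * CARD('k) * (\<delta> * hamming_weight (codeword x))) =
    (real CARD('k) - 1) * (real ?k * (real CARD('a) - 1)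
      - 2 * real ?u * ((\<sigma> - 1) / 2) - 2 * (real ?k - real ?u) * ((- \<sigma> - 1) / 2))"
    by (simp only: of_real_eq_iff)
  also have "real ?k * (real CARD('a) - 1)
      - 2 * real ?u * ((\<sigma> - 1) / 2) - 2 * (real ?k - real ?u) * ((- \<sigma> - 1) / 2) =
      real ?k * real CARD('a) + (real ?k - 2 * real ?u) * \<sigma>"
    by (simp add: field_simps)
  finally show ?thesis .
qed

lemma sqrt_card_less: "sqrt CARD('a) < real CARD('a)"
proof -
  have "1 < real CARD('a)" using CARD_ge_2 by simp
  then have "sqrt CARD('a) * 1 < sqrt CARD('a) * sqrt CARD('a)"
    by (intro mult_strict_left_mono) auto
  then show ?thesis by simp
qed

text \<open>With \<open>0 \<le> u \<le> k\<close> one has |k - 2u| at most k, so the bound does not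
  depend on the sign of \<open>\<sigma>\<close>.\<close>

lemma weight_lower_bound:
  "real (e * CARD('k) * (\<delta> * hamming_weight (codeword x))) \<ge>
    (real CARD('k) - 1) * (real (card (supp (weighted x))) * (real CARD('a) - sqrt CARD('a)))"
proof -
  obtain \<sigma> where \<sigma>: "\<sigma> = sqrt CARD('a) \<or> \<sigma> = - sqrt CARD('a)"
    "eta True = of_real ((\<sigma> - 1) / 2)" "eta False = of_real ((- \<sigma> - 1) / 2)" by (rule eta_real)
  let ?k = "card (supp (weighted x))" and ?u = "card (sq_supp (weighted x))"
  have "(real ?k - 2 * real ?u) * \<sigma> \<ge> - (real ?k * sqrt CARD('a))"
  proof -
    have "\<bar>(real ?k - 2 * real ?u) * \<sigma>\<bar> = \<bar>real ?k - 2 * real ?u\<bar> * sqrt CARD('a)"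
      using \<sigma>(1) by (auto simp: abs_mult)
    also have "\<dots> \<le> real ?k * sqrt CARD('a)"
      using sq_supp_le[of "weighted x"] by (intro mult_right_mono) auto
    finally show ?thesis by linarith
  qed
  then have "real ?k * (real CARD('a) - sqrt CARD('a)) \<le> real ?k * real CARD('a) + (real ?k - 2 * real ?u) * \<sigma>"
    by (simp add: right_diff_distrib)
  moreover have "real CARD('k) - 1 \<ge> 0" using card_base_ge_2 by simp
  ultimately show ?thesis unfolding weight_real[OF \<sigma>(2,3)] by (intro mult_left_mono)
qed

end

section \<open>Linearity, dimension and cyclicity of the code\<close>

context trace_code_setting
begin

interpretation field_hom \<iota> by (rule hom)

abbreviation inputs :: "(nat \<Rightarrow> 'a) set" where
  "inputs \<equiv> PiE {1..<e} (\<lambda>_. UNIV)"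

abbreviation zero_sums :: "(nat \<Rightarrow> 'a) set" where
  "zero_sums \<equiv> {w \<in> PiE {..<e} (\<lambda>_. UNIV). (\<Sum>h<e. w h) = 0}"

lemma index_set: "{1..<e} = {1..t}"
  using e_eq by auto

lemma codeword_carrier: "codeword x \<in> carrier_vec n"
  by (simp add: codeword_def)

lemma dim_codeword: "dim_vec (codeword x) = n"
  by (simp add: codeword_def)

lemma codeword_add: "codeword x + codeword y = codeword (\<lambda>j. x j + y j)"
proof -
  have "evaluation (\<lambda>j. x j + y j) i = evaluation x i + evaluation y i" for i
    by (simp add: evaluation_def distrib_right sum.distrib)
  then show ?thesis by (intro eq_vecI) (auto simp: codeword_def rel_trace_add)
qed

lemma codeword_smult: "c \<cdot>\<^sub>v codeword x = codeword (\<lambda>j. \<iota> c * x j)"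
proof -
  have "evaluation (\<lambda>j. \<iota> c * x j) i = \<iota> c * evaluation x i" for i
    by (simp add: evaluation_def sum_distrib_left mult.assoc)
  then show ?thesis by (intro eq_vecI) (auto simp: codeword_def rel_trace_scale)
qed

lemma codeword_zero: "codeword (\<lambda>_. 0) = 0\<^sub>v n"
  by (intro eq_vecI) (auto simp: codeword_def evaluation_def)

lemma codeword_diff: "codeword x - codeword y = codeword (\<lambda>j. x j - y j)"
proof -
  have "codeword (\<lambda>j. x j - y j) + codeword y = codeword x" by (simp add: codeword_add)
  then have "codeword x - codeword y = codeword (\<lambda>j. x j - y j) + codeword y - codeword y" by simp
  also have "\<dots> = codeword (\<lambda>j. x j - y j)"
    by (intro eq_vecI) (auto simp: codeword_def)
  finally show ?thesis .
qed

text \<open>The code is parametrised by all functions, the Fourier bijection by extensional ones;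
  this lemma and the next one pass between the two.\<close>

lemma codeword_restrict: "codeword (restrict x {1..<e}) = codeword x"
proof -
  have "evaluation (restrict x {1..<e}) i = evaluation x i" for i
    unfolding evaluation_def index_set by (intro sum.cong) auto
  then show ?thesis by (simp add: codeword_def)
qed

lemma weighted_restrict: "weighted (restrict x {1..<e}) = weighted x"
proof -
  have "transform (restrict x {1..<e}) h = transform x h" for h
    unfolding transform_def by (intro sum.cong) auto
  then show ?thesis by (simp add: weighted_def)
qed

lemma weighted_mem: "weighted x \<in> zero_sums"
proof -
  have "restrict x {1..<e} \<in> inputs" by auto
  then have "weighted (restrict x {1..<e}) \<in> zero_sums"
    using bij_betw_weighted unfolding bij_betw_def by blast
  then show ?thesis by (simp only: weighted_restrict)
qed

lemma range_codeword: "range codeword = codeword ` inputs"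
proof
  show "range codeword \<subseteq> codeword ` inputs"
  proof (rule image_subsetI)
    fix x
    have "restrict x {1..<e} \<in> inputs" by auto
    then show "codeword x \<in> codeword ` inputs" using codeword_restrict[of x] by (metis imageI)
  qed
qed auto

lemma supp_empty_iff:
  assumes "w \<in> zero_sums"
  shows "supp w = {} \<longleftrightarrow> w = (\<lambda>h\<in>{..<e}. 0)"
proof
  assume "supp w = {}"
  then have "\<And>h. h \<in> {..<e} \<Longrightarrow> w h = 0" by (auto simp: supp_def)
  moreover have "w \<in> extensional {..<e}" using assms by (auto simp: PiE_def)
  ultimately show "w = (\<lambda>h\<in>{..<e}. 0)" by (intro extensionalityI[of _ "{..<e}"]) auto
next
  assume "w = (\<lambda>h\<in>{..<e}. 0)"
  then show "supp w = {}" by (auto simp: supp_def)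
qed

text \<open>A single nonzero term cannot sum to zero, which is why \<open>k\<close> starts at 2 in
  the weight distribution.\<close>

lemma supp_ge_2:
  assumes "w \<in> zero_sums" "supp w \<noteq> {}"
  shows "card (supp w) \<ge> 2"
proof (rule ccontr)
  assume "\<not> card (supp w) \<ge> 2"
  moreover have "card (supp w) \<noteq> 0" using assms(2) supp_finite by simp
  ultimately have "card (supp w) = 1" by linarith
  then obtain h where h: "supp w = {h}" by (rule card_1_singletonE)
  have "(\<Sum>i<e. w i) = (\<Sum>i\<in>supp w. w i)"
    by (rule sum.mono_neutral_right) (auto simp: supp_def)
  then have "w h = 0" using assms(1) h by simp
  moreover have "h \<in> supp w" using h by simp
  ultimately show False by (simp add: supp_def)
qed

lemma weight_zero_imp_supp_empty:
  assumes "hamming_weight (codeword x) = 0"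
  shows "supp (weighted x) = {}"
proof (rule ccontr)
  assume "supp (weighted x) \<noteq> {}"
  then have "card (supp (weighted x)) > 0" using supp_finite by (simp add: card_gt_0_iff)
  then have "(real CARD('k) - 1) * (real (card (supp (weighted x))) * (real CARD('a) - sqrt CARD('a))) > 0"
    using card_base_ge_2 sqrt_card_less by simp
  then show False using weight_lower_bound[of x] by (simp add: assms)
qed

text \<open>The difference of two inputs with the same word has weight zero, hence empty weighted
  support, hence vanishes by the Fourier bijection.\<close>

lemma inj_on_codeword: "inj_on codeword inputs"
proof (rule inj_onI)
  fix x y assume xy: "x \<in> inputs" "y \<in> inputs" "codeword x = codeword y"
  let ?z = "\<lambda>j. x j - y j"
  have "codeword ?z = 0\<^sub>v n"
    using codeword_diff[of x y] xy(3) codeword_carrier[of y] by simp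
  then have "hamming_weight (codeword ?z) = 0" by (simp add: hamming_weight_def)
  then have "supp (weighted ?z) = {}" by (rule weight_zero_imp_supp_empty)
  then have 1: "weighted ?z = (\<lambda>h\<in>{..<e}. 0)" using supp_empty_iff weighted_mem by blast
  have "transform (\<lambda>_. 0) h = 0" for h by (simp add: transform_def)
  then have "weighted (\<lambda>_. 0) = (\<lambda>h\<in>{..<e}. 0)" unfolding weighted_def by (simp only: mult_zero_right)
  \<comment> \<open>A difference of extensional functions need not be extensional, so both sides are
    restricted before injectivity is used.\<close>
  then have "weighted (restrict ?z {1..<e}) = weighted (restrict (\<lambda>_. 0) {1..<e})"
    unfolding weighted_restrict 1 by simp
  moreover have "restrict ?z {1..<e} \<in> inputs" "restrict (\<lambda>_. 0) {1..<e} \<in> inputs" by auto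
  ultimately have "restrict ?z {1..<e} = restrict (\<lambda>_. 0) {1..<e}"
    using bij_betw_weighted unfolding bij_betw_def inj_on_def by blast
  then have "x j = y j" if "j \<in> {1..<e}" for j using that by (metis (no_types, lifting) eq_iff_diff_eq_0 restrict_apply')
  then show "x = y" using xy by (intro extensionalityI[of _ "{1..<e}"]) (auto simp: PiE_def)
qed

lemma subspace_code: "VectorSpace.subspace class_ring (range codeword) (module_vec TYPE('k) n)"
proof (rule VectorSpace.subspace.intro)
  show "vectorspace (class_ring :: 'k ring) (module_vec TYPE('k) n)" by (rule vec_vs)
  show "LinearCombinations.submodule class_ring (range codeword) (module_vec TYPE('k) n)"
  proof (rule LinearCombinations.submodule.intro)
    show "module (class_ring :: 'k ring) (module_vec TYPE('k) n)" by (rule vec_module)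
    show "range codeword \<subseteq> carrier (module_vec TYPE('k) n)"
      using codeword_carrier by (auto simp: module_vec_simps)
    show "\<zero>\<^bsub>module_vec TYPE('k) n\<^esub> \<in> range codeword"
      unfolding module_vec_simps using codeword_zero by (metis rangeI)
  next
    fix v w assume "v \<in> range codeword" "w \<in> range codeword"
    then show "v \<oplus>\<^bsub>module_vec TYPE('k) n\<^esub> w \<in> range codeword"
      unfolding module_vec_simps using codeword_add by fastforce
  next
    fix c :: 'k and v assume "v \<in> range codeword"
    then show "c \<odot>\<^bsub>module_vec TYPE('k) n\<^esub> v \<in> range codeword"
      unfolding module_vec_simps using codeword_smult by fastforce
  qed
qed

lemma card_code: "card (range codeword) = CARD('k) ^ (t * m)"
proof -
  have "card (range codeword) = card inputs"
    unfolding range_codeword by (rule card_image[OF inj_on_codeword])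
  also have "\<dots> = CARD('a) ^ t" using e_eq by (simp add: card_PiE)
  finally show ?thesis by (simp add: card_ext mult.commute flip: power_mult)
qed

text \<open>Moving from position \<open>i\<close> to \<open>i - 1\<close> multiplies the j-th term
  by the constant \<open>\<gamma> powi (- as j)\<close>; periodicity modulo \<open>n\<close> covers
  the wrap-around at \<open>i = 0\<close>.\<close>

lemma cyclic_shift_codeword: "cyclic_shift (codeword x) = codeword (\<lambda>j. x j * \<gamma> powi (- as j))"
proof (rule eq_vecI)
  fix i assume "i < dim_vec (codeword (\<lambda>j. x j * \<gamma> powi (- as j)))"
  then have i: "i < n" by (simp add: codeword_def)
  have "[int ((i + n - 1) mod n) = int i - 1] (mod int n)"
  proof -
    have "[int ((i + n - 1) mod n) = int (i + n - 1)] (mod int n)" by (simp add: cong_def zmod_int)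
    also have "int (i + n - 1) = int i - 1 + int n" using n_pos by simp
    also have "[int i - 1 + int n = int i - 1] (mod int n)" by (simp add: cong_def)
    finally show ?thesis .
  qed
  then have "evaluation x (int ((i + n - 1) mod n)) = evaluation x (int i - 1)" by (rule evaluation_cong)
  also have "\<dots> = evaluation (\<lambda>j. x j * \<gamma> powi (- as j)) (int i)"
    unfolding evaluation_def
  proof (intro sum.cong refl)
    fix j
    have "\<gamma> powi (as j * (int i - 1)) = \<gamma> powi (- as j + as j * int i)" by (simp add: algebra_simps)
    also have "\<dots> = \<gamma> powi (- as j) * \<gamma> powi (as j * int i)"
      using gen_nonzero by (simp only: power_int_add simp_thms)
    finally show "x j * \<gamma> powi (as j * (int i - 1)) = x j * \<gamma> powi (- as j) * \<gamma> powi (as j * int i)"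
      by (simp only: mult.assoc)
  qed
  finally show "cyclic_shift (codeword x) $ i = codeword (\<lambda>j. x j * \<gamma> powi (- as j)) $ i"
    using i n_pos by (simp add: cyclic_shift_def codeword_def)
qed (simp add: cyclic_shift_def codeword_def)

lemma is_cyclic_code_range: "is_cyclic_code n (t * m) (range codeword)"
  unfolding is_cyclic_code_def
proof (intro conjI ballI)
  fix c assume "c \<in> range codeword"
  then obtain x where "c = codeword x" by blast
  then show "cyclic_shift c \<in> range codeword" by (simp only: cyclic_shift_codeword rangeI)
qed (rule subspace_code, rule dim_subspace_from_card[OF subspace_code card_code])

section \<open>Weight distribution\<close>

definition weight_value :: "nat \<Rightarrow> nat \<Rightarrow> complex" where
  "weight_value k u = (of_nat CARD('k) - 1) / ((of_nat t + 1) * of_nat CARD('k) * of_nat \<delta>) *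
     (of_nat k * (of_nat CARD('a) - 1) - 2 * of_nat u * eta True - 2 * (of_nat k - of_nat u) * eta False)"

lemma weight_eq_value:
  "of_nat (hamming_weight (codeword x)) =
    weight_value (card (supp (weighted x))) (card (sq_supp (weighted x)))"
proof -
  have te: "(of_nat t + 1 :: complex) = of_nat e" by (simp add: e_eq)
  have nz: "e \<noteq> 0" "CARD('k) \<noteq> 0" "\<delta> \<noteq> 0" using e_pos delta_pos by auto
  have "weight_value (card (supp (weighted x))) (card (sq_supp (weighted x))) =
      of_nat (e * CARD('k) * (\<delta> * hamming_weight (codeword x))) / of_nat (e * CARD('k) * \<delta>)"
    unfolding weight_formula weight_value_def times_divide_eq_left te by (simp only: of_nat_mult)
  also have "\<dots> = of_nat (hamming_weight (codeword x))"
    using nz by (simp add: mult.assoc)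
  finally show ?thesis by simp
qed

text \<open>\<open>codeword\<close> and \<open>weighted\<close> are both injective on the inputs, so
  words can be counted as zero-sum vectors.\<close>

lemma card_weight_eq:
  "card {c \<in> range codeword. of_nat (hamming_weight c) = W} =
    card {w \<in> zero_sums. weight_value (card (supp w)) (card (sq_supp w)) = W}"
proof -
  let ?X = "{x \<in> inputs. of_nat (hamming_weight (codeword x)) = W}"
  have "{c \<in> range codeword. of_nat (hamming_weight c) = W} = codeword ` ?X"
    unfolding range_codeword by auto
  moreover have "{w \<in> zero_sums. weight_value (card (supp w)) (card (sq_supp w)) = W} = weighted ` ?X"
  proof -
    have "zero_sums = weighted ` inputs" using bij_betw_weighted by (simp only: bij_betw_def)
    then show ?thesis unfolding weight_eq_value by auto
  qed
  moreover have "inj_on codeword ?X" "inj_on weighted ?X"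
    using inj_on_codeword bij_betw_weighted unfolding bij_betw_def
    by (auto intro: inj_on_subset)
  ultimately show ?thesis by (simp only: card_image)
qed

text \<open>Vectors are grouped by the pair (k, u) rather than by weight, so coinciding values add
  up by themselves. The pair (0, 0) belongs to the zero vector only.\<close>

lemma weight_distribution:
  "real (card {c \<in> range codeword. of_nat (hamming_weight c) = W}) =
    (if W = 0 then 1 else 0) +
    (\<Sum>k=2..e. \<Sum>u=0..k. if W = weight_value k u
       then real (card {w \<in> zero_sums. card (supp w) = k \<and> card (sq_supp w) = u}) else 0)"
proof -
  let ?f = "\<lambda>w. (card (supp w), card (sq_supp w))"
  let ?A = "{w \<in> zero_sums. weight_value (card (supp w)) (card (sq_supp w)) = W}"
  let ?Y = "insert (0, 0) (SIGMA k:{2..e}. {0..k})"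
  let ?zero = "\<lambda>h\<in>{..<e}. 0 :: 'a"
  have "finite (PiE {..<e} (\<lambda>_. UNIV :: 'a set))" by (intro finite_PiE) auto
  then have finZ: "finite zero_sums" by simp
  have zmem: "?zero \<in> zero_sums" by auto
  have z0: "supp ?zero = {}" using supp_empty_iff[OF zmem] by blast
  have fY: "?f w \<in> ?Y" if "w \<in> zero_sums" for w
  proof (cases "supp w = {}")
    case True
    then have "sq_supp w = {}" using sq_supp_subset by blast
    then show ?thesis using True by simp
  next
    case False
    then show ?thesis using supp_ge_2[OF that] supp_le sq_supp_le by simp
  qed
  have "finite ?A" by (rule finite_subset[OF _ finZ]) blast
  moreover have "finite ?Y" by simp
  moreover have "?f ` ?A \<subseteq> ?Y" by (rule image_subsetI, rule fY) simp
  ultimately have "card ?A = (\<Sum>y\<in>?Y. card {w \<in> ?A. ?f w = y})" by (rule card_eq_sum_fibres)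
  also have "\<dots> = card {w \<in> ?A. ?f w = (0, 0)} + (\<Sum>y\<in>(SIGMA k:{2..e}. {0..k}). card {w \<in> ?A. ?f w = y})"
    by (rule sum.insert) auto
  finally have split: "card ?A =
      card {w \<in> ?A. ?f w = (0, 0)} + (\<Sum>y\<in>(SIGMA k:{2..e}. {0..k}). card {w \<in> ?A. ?f w = y})" .
  have Sigma: "(\<Sum>y\<in>(SIGMA k:{2..e}. {0..k}). card {w \<in> ?A. ?f w = y}) =
      (\<Sum>k=2..e. \<Sum>u=0..k. card {w \<in> ?A. ?f w = (k, u)})"
    by (subst sum.Sigma) (simp_all only: finite_atLeastAtMost ball_triv simp_thms split_def prod.collapse)
  have zero: "real (card {w \<in> ?A. ?f w = (0, 0)}) = (if W = 0 then 1 else 0)"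
  proof -
    have sq0: "sq_supp ?zero = {}" using sq_supp_subset[of ?zero] unfolding z0 by blast
    have v0: "weight_value 0 0 = 0" by (simp add: weight_value_def)
    have mem: "w \<in> {w \<in> ?A. ?f w = (0, 0)} \<longleftrightarrow> w = ?zero \<and> W = 0" for w
    proof
      assume w: "w \<in> {w \<in> ?A. ?f w = (0, 0)}"
      have wz: "w \<in> zero_sums" using w by blast
      have c: "card (supp w) = 0" "card (sq_supp w) = 0" using w by simp_all
      have v: "weight_value (card (supp w)) (card (sq_supp w)) = W" using w by blast
      have "supp w = {}" using c(1) supp_finite by (simp only: card_0_eq)
      then show "w = ?zero \<and> W = 0" using v unfolding c v0 by (simp only: supp_empty_iff[OF wz])
    next
      assume "w = ?zero \<and> W = 0"
      then show "w \<in> {w \<in> ?A. ?f w = (0, 0)}"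
        using zmem by (simp only: mem_Collect_eq z0 sq0 card.empty v0 simp_thms)
    qed
    have eq: "{w \<in> ?A. ?f w = (0, 0)} = {w. w = ?zero \<and> W = 0}"
    proof (rule Set.set_eqI)
      fix w
      show "w \<in> {w \<in> ?A. ?f w = (0, 0)} \<longleftrightarrow> w \<in> {w. w = ?zero \<and> W = 0}"
        using mem[of w] by (simp only: mem_Collect_eq)
    qed
    show ?thesis unfolding eq by (cases "W = 0") simp_all
  qed
  have block: "real (card {w \<in> ?A. ?f w = (k, u)}) = (if W = weight_value k u
       then real (card {w \<in> zero_sums. card (supp w) = k \<and> card (sq_supp w) = u}) else 0)" for k u
  proof -
    have eq: "{w \<in> ?A. ?f w = (k, u)} =
        (if W = weight_value k u then {w \<in> zero_sums. card (supp w) = k \<and> card (sq_supp w) = u} else {})"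
      by (cases "W = weight_value k u") auto
    show ?thesis unfolding eq by (simp only: card.empty of_nat_0 split: if_split) simp
  qed
  show ?thesis unfolding card_weight_eq split Sigma by (simp only: of_nat_add of_nat_sum zero block)
qed

lemma card_profile:
  assumes "k \<ge> 1"
  shows "real (card {w \<in> zero_sums. card (supp w) = k \<and> card (sq_supp w) = u}) =
    (\<Sum>k0=0..k. \<Sum>u0=0..u.
       real (card {h \<in> {..<e}. square_coef h} choose k0) *
       real (card {h \<in> {..<e}. \<not> square_coef h} choose (k - k0)) *
       real (k0 choose u0) * real ((k - k0) choose (u - u0)) *
       Omega CARD('a) (2 * u0 + k - k0 - u) (k0 + u - 2 * u0))"
proof -
  have "{w \<in> zero_sums. card (supp w) = k \<and> card (sq_supp w) = u} =
    {w \<in> PiE {..<e} (\<lambda>_. UNIV). (\<Sum>h<e. w h) = 0 \<and> card {h \<in> {..<e}. w h \<noteq> 0} = k \<and>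
      card {h \<in> {..<e}. w h \<noteq> 0 \<and> is_square (w h) = square_coef h} = u}"
    by (simp only: supp_def sq_supp_def mem_Collect_eq conj_assoc)
  then show ?thesis
    using card_zero_sums_profile[OF finite_lessThan is_square_minus_1 assms, of e square_coef u] by simp
qed

section \<open>Minimum distance\<close>

text \<open>
  Among the coefficients at \<open>0, 1, 2\<close> two lie in the same square class, so a word supported on
  these two positions realises the extreme weight, whatever the sign of \<open>\<sigma>\<close>.
\<close>

lemma minimum_weight_attained:
  obtains x where "real (e * CARD('k) * (\<delta> * hamming_weight (codeword x))) =
      (real CARD('k) - 1) * (2 * (real CARD('a) - sqrt CARD('a)))" "codeword x \<noteq> 0\<^sub>v n"
proof -
  obtain \<sigma> where \<sigma>: "\<sigma> = sqrt CARD('a) \<or> \<sigma> = - sqrt CARD('a)"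
    "eta True = of_real ((\<sigma> - 1) / 2)" "eta False = of_real ((- \<sigma> - 1) / 2)" by (rule eta_real)
  obtain h h' where hh: "h < e" "h' < e" "h \<noteq> h'" "square_coef h = square_coef h'"
  proof -
    have "square_coef 0 = square_coef 1 \<or> square_coef 0 = square_coef 2 \<or> square_coef 1 = square_coef 2" by auto
    moreover have "0 < e" "1 < e" "2 < e" using e_eq t_ge_2 by auto
    ultimately show ?thesis using that[of 0 1] that[of 0 2] that[of 1 2] by auto
  qed
  define b where "b = (\<sigma> = sqrt CARD('a))"
  \<comment> \<open>With this choice of \<open>z\<close> both positions lie in
    \<open>sq_supp\<close> when \<open>\<sigma>\<close> is positive, and neither does otherwise. The
    entry \<open>- z\<close> has the same class as \<open>z\<close> because -1 is a square.\<close>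
  define z where "z = (if square_coef h = b then 1 else \<gamma>)"
  have "\<not> is_square \<gamma>" using is_square_powi_iff[of 1] by simp
  then have sqz: "is_square z \<longleftrightarrow> (square_coef h = b)" and z0: "z \<noteq> 0"
    using gen_nonzero by (auto simp: z_def)
  have sqmz: "is_square (- z) = is_square z"
    using is_square_mult_iff[of "- 1" z] z0 is_square_minus_1 by simp
  define w where "w = (\<lambda>i\<in>{..<e}. if i = h then z else if i = h' then - z else 0)"
  have "(\<Sum>i<e. w i) = (\<Sum>i\<in>{h, h'}. w i)"
    using hh by (intro sum.mono_neutral_right) (auto simp: w_def)
  also have "\<dots> = 0" using hh by (auto simp: w_def)
  finally have "w \<in> zero_sums" by (auto simp: w_def)
  then obtain x where x: "weighted x = w"
    using bij_betw_weighted unfolding bij_betw_def by (metis (no_types, lifting) imageE)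
  have sw: "supp w = {h, h'}" using hh z0 by (auto simp: supp_def w_def)
  have qw: "sq_supp w = (if b then {h, h'} else {})"
    using hh z0 sqz sqmz by (auto simp: sq_supp_def w_def split: if_splits)
  have "real (card (supp w)) * real CARD('a) + (real (card (supp w)) - 2 * real (card (sq_supp w))) * \<sigma> =
      2 * (real CARD('a) - sqrt CARD('a))"
  proof (cases b)
    case True
    then have "\<sigma> = sqrt CARD('a)" by (simp add: b_def)
    then show ?thesis using sw qw hh True by simp
  next
    case False
    then have "\<sigma> = - sqrt CARD('a)" using \<sigma>(1) by (simp add: b_def)
    then show ?thesis using sw qw hh False by simp
  qed
  then have wt: "real (e * CARD('k) * (\<delta> * hamming_weight (codeword x))) =
      (real CARD('k) - 1) * (2 * (real CARD('a) - sqrt CARD('a)))"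
    using weight_real[OF \<sigma>(2,3), of x] unfolding x by simp
  have "codeword x \<noteq> 0\<^sub>v n"
  proof
    assume "codeword x = 0\<^sub>v n"
    then have "hamming_weight (codeword x) = 0" by (simp add: hamming_weight_def)
    then have "supp w = {}" using weight_zero_imp_supp_empty[of x] x by simp
    then show False using sw by simp
  qed
  then show ?thesis using that wt by blast
qed

lemma min_distance_range:
  "real (min_distance (range codeword)) =
    2 * (real CARD('k) - 1) * (real CARD('a) - sqrt CARD('a)) / ((real t + 1) * real CARD('k) * real \<delta>)"
proof -
  let ?S = "{hamming_dist c d | c d. c \<in> range codeword \<and> d \<in> range codeword \<and> c \<noteq> d}"
  let ?v = "(real CARD('k) - 1) * (2 * (real CARD('a) - sqrt CARD('a)))"
  have pos: "real e * real CARD('k) * real \<delta> > 0" using e_eq delta_pos by simp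
  obtain x where x: "real (e * CARD('k) * (\<delta> * hamming_weight (codeword x))) = ?v" "codeword x \<noteq> 0\<^sub>v n"
    by (rule minimum_weight_attained)
  have "hamming_dist (codeword x) (codeword (\<lambda>_. 0)) = hamming_weight (codeword x)"
    by (simp only: hamming_dist_eq_weight[OF dim_codeword dim_codeword] codeword_diff diff_zero)
  moreover have "codeword x \<noteq> codeword (\<lambda>_. 0)" using x(2) codeword_zero by simp
  ultimately have mem: "hamming_weight (codeword x) \<in> ?S"
    by (intro CollectI exI[of _ "codeword x"] exI[of _ "codeword (\<lambda>_. 0)"]) auto
  have "hamming_weight (codeword x) \<le> y" if "y \<in> ?S" for y
  proof -
    from that obtain c d where cd: "y = hamming_dist (codeword c) (codeword d)" "codeword c \<noteq> codeword d"
      by auto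
    let ?z = "\<lambda>j. c j - d j"
    have y: "y = hamming_weight (codeword ?z)"
      by (simp only: cd(1) hamming_dist_eq_weight[OF dim_codeword dim_codeword] codeword_diff)
    have "supp (weighted ?z) \<noteq> {}"
    proof
      assume "supp (weighted ?z) = {}"
      then have "sq_supp (weighted ?z) = {}" using sq_supp_subset by blast
      then have "complex_of_nat (hamming_weight (codeword ?z)) = 0"
        unfolding weight_eq_value using \<open>supp (weighted ?z) = {}\<close> by (simp add: weight_value_def)
      then have "card {i. i < n \<and> codeword c $ i \<noteq> codeword d $ i} = 0"
        using y cd(1) by (simp add: hamming_dist_def dim_codeword)
      then have "codeword c $ i = codeword d $ i" if "i < n" for i using that by auto
      then show False using cd(2) eq_vecI[of "codeword d" "codeword c"] by (simp add: dim_codeword)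
    qed
    then have "card (supp (weighted ?z)) \<ge> 2" by (rule supp_ge_2[OF weighted_mem])
    \<comment> \<open>\<open>?v\<close> is the lower bound for a support of size 2, the smallest
      possible nonempty one.\<close>
    then have "?v \<le> (real CARD('k) - 1) * (real (card (supp (weighted ?z))) * (real CARD('a) - sqrt CARD('a)))"
      using card_base_ge_2 sqrt_card_less by (intro mult_left_mono mult_right_mono) auto
    also have "\<dots> \<le> real (e * CARD('k) * (\<delta> * hamming_weight (codeword ?z)))"
      by (rule weight_lower_bound)
    finally have "real e * real CARD('k) * real \<delta> * real (hamming_weight (codeword x)) \<le>
        real e * real CARD('k) * real \<delta> * real y"
      using x(1) y by (simp add: mult.assoc)
    then show ?thesis using pos by (simp only: mult_le_cancel_left_pos of_nat_le_iff)
  qed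
  then have "min_distance (range codeword) = hamming_weight (codeword x)"
    unfolding min_distance_def by (intro cInf_eq_minimum mem)
  moreover have "real (hamming_weight (codeword x)) = ?v / (real e * real CARD('k) * real \<delta>)"
    unfolding x(1)[symmetric] using e_pos delta_pos by simp
  moreover have "real e = real t + 1" by (simp add: e_eq)
  ultimately show ?thesis by (simp only: mult_ac)
qed

end

theorem theorem3:
  fixes \<iota> :: "'k::{field,finite} \<Rightarrow> 'a::{field,finite}"
    and p s m q r e t n \<delta> l0 l1 :: nat
    and a N :: int
    and \<Delta> as :: "nat \<Rightarrow> int"
    and \<gamma> g \<beta> :: 'a
    and lam :: "nat \<Rightarrow> 'a"
    and \<eta>0 \<eta>1 :: complex
    and C :: "'k vec set"
  assumes "prime p" "s \<ge> 1" "m \<ge> 1" "q = p ^ s" "r = q ^ m"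
    and "CARD('k) = q" "CARD('a) = r" "field_hom \<iota>"
    and "mult_generator \<gamma>"
    and "t \<ge> 2" "e \<ge> t" "e dvd r - 1"
    and "\<not> [a = 0] (mod int (r - 1))"
    and "\<forall>i\<in>{1..t}. \<forall>j\<in>{1..t}. i \<noteq> j \<longrightarrow> \<not> [\<Delta> i = \<Delta> j] (mod int e)"
    and "Gcd (insert (int e) ((\<lambda>i. \<Delta> i - \<Delta> 1) ` {2..t})) = 1"
    and "\<forall>i\<in>{1..t}. [as i = a + int ((r - 1) div e) * \<Delta> i] (mod int (r - 1))"
    and "\<forall>i\<in>{1..t}. degree (min_poly \<iota> (\<gamma> powi (- as i))) = m"
    and "inj_on (\<lambda>i. min_poly \<iota> (\<gamma> powi (- as i))) {1..t}"
    and "N = gcd (int ((r - 1) div (q - 1))) (a * int e)"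
    and "int \<delta> = Gcd (insert (int (r - 1)) (as ` {1..t}))"
    and "n = (r - 1) div \<delta>"
    and "C = trace_code \<iota> m \<gamma> n t as"
    and "g = \<gamma> powi a" "\<beta> = \<gamma> ^ ((r - 1) div e)"
    and "lam = relation_coeffs (B_mat \<beta> t \<Delta>) t"
    and "l0 = card {i \<in> {1..t}. is_square (lam i * g ^ i)}"
    and "l1 = card {i \<in> {1..t}. \<not> is_square (lam i * g ^ i)}"
    and "\<eta>0 = (\<Sum>x\<in>{x::'a. x \<noteq> 0 \<and> is_square x}. add_char p (s * m) x)"
    and "\<eta>1 = - 1 - \<eta>0"
    and "N = 2" "t = e - 1"
  shows "is_cyclic_code n (t * m) C \<and>
    real (min_distance C) =
      2 * (real q - 1) * (real r - sqrt r) / ((real t + 1) * real q * real \<delta>) \<and>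
    (\<forall>w::complex.
      real (card {c \<in> C. of_nat (hamming_weight c) = w}) =
        (if w = 0 then 1 else 0) +
        (\<Sum>k=2..t+1. \<Sum>u=0..k.
          if w = (of_nat q - 1) / ((of_nat t + 1) * of_nat q * of_nat \<delta>) *
                 (of_nat k * (of_nat r - 1) - 2 * of_nat u * \<eta>0 - 2 * (of_nat k - of_nat u) * \<eta>1)
          then \<Sum>k0=0..k. \<Sum>u0=0..u.
                 real ((l0 + 1) choose k0) * real (l1 choose (k - k0)) *
                 real (k0 choose u0) * real ((k - k0) choose (u - u0)) *
                 Omega r (2 * u0 + k - k0 - u) (k0 + u - 2 * u0)
          else 0))"
proof -
  note A = assms
  let ?M = "(r - 1) div (q - 1)"
  have q: "CARD('k) = q" and r: "CARD('a) = r" using A(6,7) .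
  have e_eq: "e = t + 1" using A(10,11) \<open>t = e - 1\<close> by linarith
  interpret ext: finite_field_extension \<iota> p s m
    using A(1,4,5,8) q r by (intro finite_field_extension.intro) simp_all
  interpret cyclic_field \<gamma> by unfold_locales (rule A(9))
  have q2: "q \<ge> 2" using ext.card_base_ge_2 q by simp
  have r2: "r \<ge> 2" using CARD_ge_2 r by simp
  have "int q - 1 dvd int q ^ m - 1" by (metis dvd_triv_left power_diff_1_eq)
  then have "int (q - 1) dvd int (r - 1)" using q2 r2 by (simp add: of_nat_diff A(5))
  then have index: "r - 1 = (q - 1) * ?M" by (simp only: int_dvd_int_iff dvd_mult_div_cancel)
  have gcd2: "gcd (int ?M) (a * int e) = 2" using A(19) \<open>N = 2\<close> by simp
  have "2 dvd int ?M" unfolding gcd2[symmetric] by (rule gcd_dvd1)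
  then have even: "even ?M" by simp

  \<comment> \<open>Pigeonhole: \<open>t\<close> residues cannot cover all t + 1 classes modulo
    \<open>e\<close>, so one class \<open>d\<close> is missed.\<close>
  have "card ((\<lambda>i. nat (\<Delta> i mod int e)) ` {1..t}) \<le> card {1..t}" by (rule card_image_le) simp
  then have "card ((\<lambda>i. nat (\<Delta> i mod int e)) ` {1..t}) < card {..<e}" using e_eq by simp
  then have "\<not> {..<e} \<subseteq> (\<lambda>i. nat (\<Delta> i mod int e)) ` {1..t}"
    by (metis card_mono finite_atLeastAtMost finite_imageI not_le)
  then obtain d where d: "d < e" "d \<notin> (\<lambda>i. nat (\<Delta> i mod int e)) ` {1..t}" by auto
  define D where "D = \<Delta>(0 := int d)"
  have D0: "D 0 = int d" and D: "i \<in> {1..t} \<Longrightarrow> D i = \<Delta> i" for i by (auto simp: D_def)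
  have missing: "\<not> [int d = \<Delta> i] (mod int e)" if "i \<in> {1..t}" for i
  proof
    assume "[int d = \<Delta> i] (mod int e)"
    then have "\<Delta> i mod int e = int d" using d(1) by (simp add: cong_def)
    then have "d = nat (\<Delta> i mod int e)" by simp
    then show False using d(2) that by blast
  qed
  have distinct: "i = j" if ij: "i < e" "j < e" "[D i = D j] (mod int e)" for i j
  proof (rule ccontr)
    assume ne: "i \<noteq> j"
    consider "i = 0" "j \<in> {1..t}" | "j = 0" "i \<in> {1..t}" | "i \<in> {1..t}" "j \<in> {1..t}"
      using ne ij e_eq by force
    then show False
    proof cases
      case 1
      then show False using ij(3) D[of j] D0 missing[of j] by simp
    next
      case 2
      then show False using ij(3) D[of i] D0 missing[of i] by (simp add: cong_sym_eq)
    next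
      case 3
      then show False using ij(3) D[of i] D[of j] A(14) ne by simp
    qed
  qed
  have "int \<delta> dvd int (r - 1)" unfolding A(20) by (rule Gcd_dvd) simp
  then have "\<delta> dvd r - 1" by (simp only: int_dvd_int_iff)
  then have delta: "r - 1 = \<delta> * n" using A(21) by simp
  have delta_dvd: "int \<delta> dvd as i" if "i \<in> {1..t}" for i
    unfolding A(20) using that by (intro Gcd_dvd) simp

  interpret T: trace_code_setting \<iota> p s m \<gamma> ?M e t n \<delta> a D as
  proof (intro trace_code_setting.intro even_index_extension.intro ext.finite_field_extension_axioms
      cyclic_field_axioms even_index_extension_axioms.intro trace_code_setting_axioms.intro)
    show "[as i = a + int ((CARD('a) - 1) div e) * D i] (mod int (CARD('a) - 1))" if "i \<in> {1..t}" for i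
      using A(16) that by (simp only: D r)
    show "i = j" if "i < e" "j < e" "[D i = D j] (mod int e)" for i j
      using that by (rule distinct)
  qed (use index even A(10,12) e_eq gcd2 delta delta_dvd in \<open>simp_all only: q r\<close>)

  have beta: "T.\<beta> = \<beta>" by (simp only: T.\<beta>_def A(24) r)
  \<comment> \<open>The matrix reads the exponents only from index 1 on, so placing the missing
    residue at index 0 leaves it unchanged.\<close>
  have "B_mat \<beta> t \<Delta> = B_mat T.\<beta> t D"
    unfolding B_mat_def beta by (intro eq_matI) (auto simp: D_def)
  then have lam: "lam = restrict T.coef {1..t}"
    unfolding A(25) using T.relation_coeffs_eq[OF e_eq] by simp
  have coef: "is_square (lam i * g ^ i) \<longleftrightarrow> T.square_coef i" if "i \<in> {1..t}" for i
    using that by (simp add: lam A(23) T.square_coef_def)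
  \<comment> \<open>The coefficient at position 0 is 1, a square; this is the extra 1 in
    \<open>l0 + 1\<close>.\<close>
  have sq0: "T.square_coef 0" by (simp add: T.square_coef_def T.coef_0)
  have range: "{..<e} = insert 0 {1..t}" using e_eq by auto
  have "{h \<in> {..<e}. T.square_coef h} = insert 0 {i \<in> {1..t}. is_square (lam i * g ^ i)}"
    unfolding range using sq0 coef by blast
  then have l0: "card {h \<in> {..<e}. T.square_coef h} = l0 + 1" using A(26) by simp
  have "{h \<in> {..<e}. \<not> T.square_coef h} = {i \<in> {1..t}. \<not> is_square (lam i * g ^ i)}"
    unfolding range using sq0 coef by blast
  then have l1: "card {h \<in> {..<e}. \<not> T.square_coef h} = l1" using A(27) by simp
  have eta: "T.eta True = \<eta>0" "T.eta False = \<eta>1"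
    using A(28,29) T.eta_False by (simp_all add: T.eta_def T.sq_class_def)
  have C: "C = range T.codeword" using A(22) T.trace_code_eq by simp

  have "real (card {c \<in> C. of_nat (hamming_weight c) = w}) =
        (if w = 0 then 1 else 0) +
        (\<Sum>k=2..t+1. \<Sum>u=0..k.
          if w = (of_nat q - 1) / ((of_nat t + 1) * of_nat q * of_nat \<delta>) *
                 (of_nat k * (of_nat r - 1) - 2 * of_nat u * \<eta>0 - 2 * (of_nat k - of_nat u) * \<eta>1)
          then \<Sum>k0=0..k. \<Sum>u0=0..u.
                 real ((l0 + 1) choose k0) * real (l1 choose (k - k0)) *
                 real (k0 choose u0) * real ((k - k0) choose (u - u0)) *
                 Omega r (2 * u0 + k - k0 - u) (k0 + u - 2 * u0)
          else 0)" for w :: complex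
    unfolding C T.weight_distribution e_eq[symmetric]
  proof (intro arg_cong2[where f = "(+)"] sum.cong refl)
    fix k u assume "k \<in> {2..e}"
    then have k: "k \<ge> 1" by simp
    show "(if w = T.weight_value k u
        then real (card {w \<in> T.zero_sums. card (T.supp w) = k \<and> card (T.sq_supp w) = u}) else 0) =
      (if w = (of_nat q - 1) / ((of_nat t + 1) * of_nat q * of_nat \<delta>) *
                 (of_nat k * (of_nat r - 1) - 2 * of_nat u * \<eta>0 - 2 * (of_nat k - of_nat u) * \<eta>1)
          then \<Sum>k0=0..k. \<Sum>u0=0..u.
                 real ((l0 + 1) choose k0) * real (l1 choose (k - k0)) *
                 real (k0 choose u0) * real ((k - k0) choose (u - u0)) *
                 Omega r (2 * u0 + k - k0 - u) (k0 + u - 2 * u0)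
          else 0)"
      unfolding T.card_profile[OF k] T.weight_value_def eta q r l0 l1 by (rule refl)
  qed
  moreover have "is_cyclic_code n (t * m) C" unfolding C by (rule T.is_cyclic_code_range)
  moreover have "real (min_distance C) =
      2 * (real q - 1) * (real r - sqrt r) / ((real t + 1) * real q * real \<delta>)"
    unfolding C T.min_distance_range q r by (rule refl)
  ultimately show ?thesis by blast
qed

end
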